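(* Let $\Bbbk$ be a nontrivial commutative ring, $Q$ a small $\Bbbk$-preadditive category, and $A$ a $\Bbbk$-algebra. Assume that $Q$ is Hom-finite, locally bounded, has a Serre functor relative to $\Bbbk$ and has the Retraction Property, that $\Bbbk$ is Gorenstein, and that $A$ has finite projective/injective dimension as a $\Bbbk$-module. Let $\mathscr{E}$ be the class of exact objects in ${}_{Q,A}\mathrm{Mod}$. The two model categories given by ${}_{Q,A}\mathrm{Mod}$ with the projective model structure and ${}_{Q,A}\mathrm{Mod}$ with the injective model structure have the same weak equivalences; in fact, a morphism $\varphi$ in ${}_{Q,A}\mathrm{Mod}$ is a weak equivalence in either of the two model structures if and only if it satisfies the following equivalent conditions: (i) $\varphi=\pi\iota$ where $\iota$ is monic with $\operatorname{Coker}\iota\in\mathscr{E}$ and $\pi$ is epic with $\operatorname{Ker}\pi\in\mathscr{E}$. (ii) $\varphi=\pi\iota$ where $\iota$ is monic with $\operatorname{Coker}\iota\in{}_{Q,A}\mathrm{Prj}$ and $\pi$ is epic with $\operatorname{Ker}\pi\in\mathscr{E}$. (iii) $\varphi=\pi\iota$ where $\iota$ is monic with $\operatorname{Coker}\iota\in\mathscr{E}$ and $\pi$ is epic with $\operatorname{Ker}\pi\in{}_{Q,A}\mathrm{Inj}$.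
   Context: $\Bbbk$-preadditive category: hom sets $Q(p,q)$ are $\Bbbk$-modules and composition is $\Bbbk$-bilinear. The conditions on $Q$ are: - Hom-finite: each $Q(p,q)$ is a finitely generated projective $\Bbbk$-module. - Locally bounded: for each object $q$ the sets $\{p \mid Q(p,q)\neq 0\}$ and $\{r \mid Q(q,r)\neq 0\}$ are finite. - Serre functor relative to $\Bbbk$: there are a $\Bbbk$-linear autoequivalence $\mathbb{S}\colon Q\to Q$ and an isomorphism $Q(p,q)\cong \operatorname{Hom}_{\Bbbk}(Q(q,\mathbb{S}(p)),\Bbbk)$ natural in $p,q$. - Retraction Property: for each $q$ the map $\Bbbk\to Q(q,q)$, $x\mapsto x\cdot\mathrm{id}_q$, has a $\Bbbk$-module retraction. $\Bbbk$ is Gorenstein if it is noetherian with finite self-injective dimension; over such a ring a module has finite projective dimension iff it has finite injective dimension. ${}_{Q,A}\mathrm{Mod}$ is the category of $\Bbbk$-linear functors from $Q$ to left $A$-modules, with projective objects ${}_{Q,A}\mathrm{Prj}$ and injective objects ${}_{Q,A}\mathrm{Inj}$; ${}_{Q}\mathrm{Mod}={}_{Q,\Bbbk}\mathrm{Mod}$; $X^\natural\in{}_{Q}\mathrm{Mod}$ is $X$ with the $A$-structure forgotten. $\mathscr{E}=\{X\mid X^\natural \text{ has finite projective dimension in } {}_Q\mathrm{Mod}\}$ (equivalently, under these hypotheses, finite injective dimension). ${}^\perp\mathscr{E}=\{X\mid \operatorname{Ext}^1(X,E)=0\ \forall E\in\mathscr{E}\}$, $\mathscr{E}^\perp=\{X\mid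 \operatorname{Ext}^1(E,X)=0\ \forall E\in\mathscr{E}\}$. Abelian model structure (Hovey): the (trivial) cofibrations are the monomorphisms with (trivially) cofibrant cokernel and the (trivial) fibrations are the epimorphisms with (trivially) fibrant kernel; an object is trivial if weakly equivalent to $0$. The projective model structure is the abelian model structure on ${}_{Q,A}\mathrm{Mod}$ with cofibrant objects ${}^\perp\mathscr{E}$, trivial objects $\mathscr{E}$, and every object fibrant. The injective model structure is the abelian model structure with fibrant objects $\mathscr{E}^\perp$, trivial objects $\mathscr{E}$, and every object cofibrant. Both exist under the stated hypotheses. *)

theory Defs
  imports "HOL-Algebra.Module" "HOL-Algebra.Ring_Divisibility"
begin

section \<open>Modules and algebras\<close>

text \<open>The locale \<open>module\<close> of HOL-Algebra requires a commutative ring of scalars and its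
  locale \<open>algebra\<close> a commutative algebra. Here the scalars form an arbitrary ring.\<close>

locale left_module = R?: ring R + M?: abelian_group M
  for R :: "('r, 's) ring_scheme" (structure) and M :: "('r, 'm, 'x) module_scheme" (structure) +
  assumes smult_closed:
      "\<lbrakk>a \<in> carrier R; x \<in> carrier M\<rbrakk> \<Longrightarrow> a \<odot>\<^bsub>M\<^esub> x \<in> carrier M"
    and smult_l_distr:
      "\<lbrakk>a \<in> carrier R; b \<in> carrier R; x \<in> carrier M\<rbrakk> \<Longrightarrow>
       (a \<oplus> b) \<odot>\<^bsub>M\<^esub> x = a \<odot>\<^bsub>M\<^esub> x \<oplus>\<^bsub>M\<^esub> b \<odot>\<^bsub>M\<^esub> x"
    and smult_r_distr:
      "\<lbrakk>a \<in> carrier R; x \<in> carrier M; y \<in> carrier M\<rbrakk> \<Longrightarrow>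
       a \<odot>\<^bsub>M\<^esub> (x \<oplus>\<^bsub>M\<^esub> y) = a \<odot>\<^bsub>M\<^esub> x \<oplus>\<^bsub>M\<^esub> a \<odot>\<^bsub>M\<^esub> y"
    and smult_assoc1:
      "\<lbrakk>a \<in> carrier R; b \<in> carrier R; x \<in> carrier M\<rbrakk> \<Longrightarrow>
       (a \<otimes> b) \<odot>\<^bsub>M\<^esub> x = a \<odot>\<^bsub>M\<^esub> (b \<odot>\<^bsub>M\<^esub> x)"
    and smult_one: "x \<in> carrier M \<Longrightarrow> \<one> \<odot>\<^bsub>M\<^esub> x = x"

locale assoc_algebra = R?: module R A + A?: ring A for R (structure) and A (structure) +
  assumes smult_mult_left:
      "\<lbrakk>x \<in> carrier R; a \<in> carrier A; b \<in> carrier A\<rbrakk> \<Longrightarrow>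
       (x \<odot>\<^bsub>A\<^esub> a) \<otimes>\<^bsub>A\<^esub> b = x \<odot>\<^bsub>A\<^esub> (a \<otimes>\<^bsub>A\<^esub> b)"
    and smult_mult_right:
      "\<lbrakk>x \<in> carrier R; a \<in> carrier A; b \<in> carrier A\<rbrakk> \<Longrightarrow>
       a \<otimes>\<^bsub>A\<^esub> (x \<odot>\<^bsub>A\<^esub> b) = x \<odot>\<^bsub>A\<^esub> (a \<otimes>\<^bsub>A\<^esub> b)"

definition self_algebra :: "'k ring \<Rightarrow> ('k, 'k) module" where
  "self_algebra k = \<lparr>carrier = carrier k, monoid.mult = monoid.mult k, one = one k,
     ring.zero = ring.zero k, ring.add = ring.add k, smult = monoid.mult k\<rparr>"

definition is_linear ::
    "('r, 's) ring_scheme \<Rightarrow> ('r, 'm, 'x) module_scheme \<Rightarrow> ('r, 'n, 'y) module_scheme \<Rightarrow>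
     ('m \<Rightarrow> 'n) \<Rightarrow> bool" where
  "is_linear R M N f \<longleftrightarrow>
     f \<in> carrier M \<rightarrow> carrier N \<and>
     (\<forall>x\<in>carrier M. \<forall>y\<in>carrier M. f (x \<oplus>\<^bsub>M\<^esub> y) = f x \<oplus>\<^bsub>N\<^esub> f y) \<and>
     (\<forall>r\<in>carrier R. \<forall>x\<in>carrier M. f (r \<odot>\<^bsub>M\<^esub> x) = r \<odot>\<^bsub>N\<^esub> f x)"

definition fin_gen_module :: "'r ring \<Rightarrow> ('r, 'm) module \<Rightarrow> bool" where
  "fin_gen_module R M \<longleftrightarrow>
     (\<exists>S. finite S \<and> S \<subseteq> carrier M \<and>
       (\<forall>x\<in>carrier M. \<exists>c\<in>S \<rightarrow> carrier R. x = finsum M (\<lambda>s. c s \<odot>\<^bsub>M\<^esub> s) S))"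

text \<open>Scalars from the base ring act on an \<open>A\<close>-module through \<open>x \<mapsto> x \<cdot> 1\<^sub>A\<close>.\<close>

definition base_smult :: "('k, 'a) module \<Rightarrow> ('a, 'm) module \<Rightarrow> 'k \<Rightarrow> 'm \<Rightarrow> 'm" where
  "base_smult A M x m = (x \<odot>\<^bsub>A\<^esub> \<one>\<^bsub>A\<^esub>) \<odot>\<^bsub>M\<^esub> m"

definition restrict_scalars :: "('k, 'a) module \<Rightarrow> ('a, 'm) module \<Rightarrow> ('k, 'm) module" where
  "restrict_scalars A M = \<lparr>carrier = carrier M, monoid.mult = monoid.mult M, one = one M,
     ring.zero = ring.zero M, ring.add = ring.add M, smult = base_smult A M\<rparr>"


section \<open>Preadditive categories over a commutative ring\<close>

text \<open>Hom sets are modules indexed by pairs of objects (not assumed disjoint), so composition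
  carries its three objects: \<open>lcomp C X Y Z g f\<close> is \<open>g \<circ> f\<close> for \<open>f : X \<rightarrow> Y\<close>, \<open>g : Y \<rightarrow> Z\<close>.\<close>

record ('o, 'm, 'k) lincat =
  lobj :: "'o set"
  lhom :: "'o \<Rightarrow> 'o \<Rightarrow> ('k, 'm) module"
  lid :: "'o \<Rightarrow> 'm"
  lcomp :: "'o \<Rightarrow> 'o \<Rightarrow> 'o \<Rightarrow> 'm \<Rightarrow> 'm \<Rightarrow> 'm"

definition arr :: "('o, 'm, 'k) lincat \<Rightarrow> 'o \<Rightarrow> 'o \<Rightarrow> 'm set" where
  "arr C X Y = carrier (lhom C X Y)"

definition zero_arr :: "('o, 'm, 'k) lincat \<Rightarrow> 'o \<Rightarrow> 'o \<Rightarrow> 'm" where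
  "zero_arr C X Y = \<zero>\<^bsub>lhom C X Y\<^esub>"

locale linear_category =
  fixes k :: "'k ring" and C :: "('o, 'm, 'k) lincat"
  assumes hom_module: "\<lbrakk>X \<in> lobj C; Y \<in> lobj C\<rbrakk> \<Longrightarrow> module k (lhom C X Y)"
    and id_arr: "X \<in> lobj C \<Longrightarrow> lid C X \<in> arr C X X"
    and comp_arr: "\<lbrakk>X \<in> lobj C; Y \<in> lobj C; Z \<in> lobj C; f \<in> arr C X Y; g \<in> arr C Y Z\<rbrakk> \<Longrightarrow>
      lcomp C X Y Z g f \<in> arr C X Z"
    and id_comp: "\<lbrakk>X \<in> lobj C; Y \<in> lobj C; f \<in> arr C X Y\<rbrakk> \<Longrightarrow> lcomp C X Y Y (lid C Y) f = f"
    and comp_id: "\<lbrakk>X \<in> lobj C; Y \<in> lobj C; f \<in> arr C X Y\<rbrakk> \<Longrightarrow> lcomp C X X Y f (lid C X) = f"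
    and comp_assoc:
      "\<lbrakk>W \<in> lobj C; X \<in> lobj C; Y \<in> lobj C; Z \<in> lobj C;
        f \<in> arr C W X; g \<in> arr C X Y; h \<in> arr C Y Z\<rbrakk> \<Longrightarrow>
       lcomp C W Y Z h (lcomp C W X Y g f) = lcomp C W X Z (lcomp C X Y Z h g) f"
    and comp_linear_right:
      "\<lbrakk>X \<in> lobj C; Y \<in> lobj C; Z \<in> lobj C; g \<in> arr C Y Z\<rbrakk> \<Longrightarrow>
       is_linear k (lhom C X Y) (lhom C X Z) (\<lambda>f. lcomp C X Y Z g f)"
    and comp_linear_left:
      "\<lbrakk>X \<in> lobj C; Y \<in> lobj C; Z \<in> lobj C; f \<in> arr C X Y\<rbrakk> \<Longrightarrow>
       is_linear k (lhom C Y Z) (lhom C X Z) (\<lambda>g. lcomp C X Y Z g f)"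

definition iso_arr :: "('o, 'm, 'k) lincat \<Rightarrow> 'o \<Rightarrow> 'o \<Rightarrow> 'm \<Rightarrow> bool" where
  "iso_arr C X Y f \<longleftrightarrow> f \<in> arr C X Y \<and>
     (\<exists>g\<in>arr C Y X. lcomp C X Y X g f = lid C X \<and> lcomp C Y X Y f g = lid C Y)"

definition isomorphic :: "('o, 'm, 'k) lincat \<Rightarrow> 'o \<Rightarrow> 'o \<Rightarrow> bool" where
  "isomorphic C X Y \<longleftrightarrow> X \<in> lobj C \<and> Y \<in> lobj C \<and> (\<exists>f. iso_arr C X Y f)"

definition monic :: "('o, 'm, 'k) lincat \<Rightarrow> 'o \<Rightarrow> 'o \<Rightarrow> 'm \<Rightarrow> bool" where
  "monic C X Y f \<longleftrightarrow> f \<in> arr C X Y \<and>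
     (\<forall>W\<in>lobj C. \<forall>g\<in>arr C W X. \<forall>h\<in>arr C W X.
        lcomp C W X Y f g = lcomp C W X Y f h \<longrightarrow> g = h)"

definition epic :: "('o, 'm, 'k) lincat \<Rightarrow> 'o \<Rightarrow> 'o \<Rightarrow> 'm \<Rightarrow> bool" where
  "epic C X Y f \<longleftrightarrow> f \<in> arr C X Y \<and>
     (\<forall>Z\<in>lobj C. \<forall>g\<in>arr C Y Z. \<forall>h\<in>arr C Y Z.
        lcomp C X Y Z g f = lcomp C X Y Z h f \<longrightarrow> g = h)"

definition is_zero :: "('o, 'm, 'k) lincat \<Rightarrow> 'o \<Rightarrow> bool" where
  "is_zero C Z \<longleftrightarrow> Z \<in> lobj C \<and> (\<forall>X\<in>lobj C. (\<exists>!f. f \<in> arr C Z X) \<and> (\<exists>!f. f \<in> arr C X Z))"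

text \<open>\<open>is_kernel C X Y f K j\<close>: the arrow \<open>j : K \<rightarrow> X\<close> is a kernel of \<open>f : X \<rightarrow> Y\<close>.\<close>

definition is_kernel :: "('o, 'm, 'k) lincat \<Rightarrow> 'o \<Rightarrow> 'o \<Rightarrow> 'm \<Rightarrow> 'o \<Rightarrow> 'm \<Rightarrow> bool" where
  "is_kernel C X Y f K j \<longleftrightarrow>
     X \<in> lobj C \<and> Y \<in> lobj C \<and> K \<in> lobj C \<and> f \<in> arr C X Y \<and> j \<in> arr C K X \<and>
     lcomp C K X Y f j = zero_arr C K Y \<and>
     (\<forall>W\<in>lobj C. \<forall>g\<in>arr C W X. lcomp C W X Y f g = zero_arr C W Y \<longrightarrow>
        (\<exists>!h. h \<in> arr C W K \<and> lcomp C W K X j h = g))"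

text \<open>\<open>is_cokernel C X Y f Z c\<close>: the arrow \<open>c : Y \<rightarrow> Z\<close> is a cokernel of \<open>f : X \<rightarrow> Y\<close>.\<close>

definition is_cokernel :: "('o, 'm, 'k) lincat \<Rightarrow> 'o \<Rightarrow> 'o \<Rightarrow> 'm \<Rightarrow> 'o \<Rightarrow> 'm \<Rightarrow> bool" where
  "is_cokernel C X Y f Z c \<longleftrightarrow>
     X \<in> lobj C \<and> Y \<in> lobj C \<and> Z \<in> lobj C \<and> f \<in> arr C X Y \<and> c \<in> arr C Y Z \<and>
     lcomp C X Y Z c f = zero_arr C X Z \<and>
     (\<forall>W\<in>lobj C. \<forall>g\<in>arr C Y W. lcomp C X Y W g f = zero_arr C X W \<longrightarrow>
        (\<exists>!h. h \<in> arr C Z W \<and> lcomp C Y Z W h c = g))"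

text \<open>The classes of objects used below are closed under isomorphism, so "the kernel lies in
  \<open>T\<close>" may be read as "some kernel lies in \<open>T\<close>".\<close>

definition mono_with_coker_in ::
    "('o, 'm, 'k) lincat \<Rightarrow> 'o set \<Rightarrow> 'o \<Rightarrow> 'o \<Rightarrow> 'm \<Rightarrow> bool" where
  "mono_with_coker_in C S X Y f \<longleftrightarrow>
     monic C X Y f \<and> (\<exists>Z\<in>S. \<exists>c. is_cokernel C X Y f Z c)"

definition epi_with_ker_in ::
    "('o, 'm, 'k) lincat \<Rightarrow> 'o set \<Rightarrow> 'o \<Rightarrow> 'o \<Rightarrow> 'm \<Rightarrow> bool" where
  "epi_with_ker_in C T X Y f \<longleftrightarrow>
     epic C X Y f \<and> (\<exists>K\<in>T. \<exists>j. is_kernel C X Y f K j)"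

definition factors_mono_epi ::
    "('o, 'm, 'k) lincat \<Rightarrow> 'o set \<Rightarrow> 'o set \<Rightarrow> 'o \<Rightarrow> 'o \<Rightarrow> 'm \<Rightarrow> bool" where
  "factors_mono_epi C S T X Y f \<longleftrightarrow>
     (\<exists>Z\<in>lobj C. \<exists>i\<in>arr C X Z. \<exists>p\<in>arr C Z Y.
        f = lcomp C X Z Y p i \<and> mono_with_coker_in C S X Z i \<and> epi_with_ker_in C T Z Y p)"

text \<open>Exactness at \<open>Y\<close>: the image of \<open>f\<close> is the kernel of \<open>g\<close>.\<close>

definition exact_at :: "('o, 'm, 'k) lincat \<Rightarrow> 'o \<Rightarrow> 'o \<Rightarrow> 'o \<Rightarrow> 'm \<Rightarrow> 'm \<Rightarrow> bool" where
  "exact_at C X Y Z f g \<longleftrightarrow>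
     (\<exists>K j e. is_kernel C Y Z g K j \<and> epic C X K e \<and> f = lcomp C X K Y j e)"


section \<open>Projective and injective objects, dimensions, first extension groups\<close>

definition projectives :: "('o, 'm, 'k) lincat \<Rightarrow> 'o set" where
  "projectives C = {P \<in> lobj C. \<forall>X\<in>lobj C. \<forall>Y\<in>lobj C. \<forall>e. epic C X Y e \<longrightarrow>
     (\<forall>f\<in>arr C P Y. \<exists>g\<in>arr C P X. lcomp C P X Y e g = f)}"

definition injectives :: "('o, 'm, 'k) lincat \<Rightarrow> 'o set" where
  "injectives C = {I \<in> lobj C. \<forall>X\<in>lobj C. \<forall>Y\<in>lobj C. \<forall>m. monic C X Y m \<longrightarrow>
     (\<forall>f\<in>arr C X I. \<exists>g\<in>arr C Y I. lcomp C X Y I g m = f)}"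

text \<open>Exact sequences \<open>0 \<rightarrow> P\<^sub>n \<rightarrow> \<dots> \<rightarrow> P\<^sub>0 \<rightarrow> X \<rightarrow> 0\<close>, with \<open>d i : P\<^sub>i\<^sub>+\<^sub>1 \<rightarrow> P\<^sub>i\<close> and \<open>P\<^sub>i = 0\<close>
  for \<open>i > n\<close>, and dually for injectives.\<close>

definition finite_proj_dim :: "('o, 'm, 'k) lincat \<Rightarrow> 'o \<Rightarrow> bool" where
  "finite_proj_dim C X \<longleftrightarrow> X \<in> lobj C \<and>
     (\<exists>(n::nat) (P::nat \<Rightarrow> 'o) (d::nat \<Rightarrow> 'm) (e::'m).
        (\<forall>i. P i \<in> projectives C) \<and> (\<forall>i>n. is_zero C (P i)) \<and>
        (\<forall>i. d i \<in> arr C (P (Suc i)) (P i)) \<and> epic C (P 0) X e \<and>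
        exact_at C (P (Suc 0)) (P 0) X (d 0) e \<and>
        (\<forall>i. exact_at C (P (Suc (Suc i))) (P (Suc i)) (P i) (d (Suc i)) (d i)))"

definition finite_inj_dim :: "('o, 'm, 'k) lincat \<Rightarrow> 'o \<Rightarrow> bool" where
  "finite_inj_dim C X \<longleftrightarrow> X \<in> lobj C \<and>
     (\<exists>(n::nat) (I::nat \<Rightarrow> 'o) (d::nat \<Rightarrow> 'm) (e::'m).
        (\<forall>i. I i \<in> injectives C) \<and> (\<forall>i>n. is_zero C (I i)) \<and>
        (\<forall>i. d i \<in> arr C (I i) (I (Suc i))) \<and> monic C X (I 0) e \<and>
        exact_at C X (I 0) (I (Suc 0)) e (d 0) \<and>
        (\<forall>i. exact_at C (I i) (I (Suc i)) (I (Suc (Suc i))) (d i) (d (Suc i))))"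

text \<open>Yoneda's \<open>Ext\<^sup>1(X, E)\<close>: equivalence classes of short exact sequences
  \<open>0 \<rightarrow> E \<rightarrow> Y \<rightarrow> X \<rightarrow> 0\<close>. Its zero element is the class of the split ones.\<close>

definition extensions :: "('o, 'm, 'k) lincat \<Rightarrow> 'o \<Rightarrow> 'o \<Rightarrow> ('o \<times> 'm \<times> 'm) set" where
  "extensions C X E =
     {(Y, i, p). is_kernel C Y X p E i \<and> is_cokernel C E Y i X p}"

definition ext_rel ::
    "('o, 'm, 'k) lincat \<Rightarrow> 'o \<Rightarrow> 'o \<Rightarrow> (('o \<times> 'm \<times> 'm) \<times> ('o \<times> 'm \<times> 'm)) set" where
  "ext_rel C X E = {((Y, i, p), (Y', i', p')).
     (Y, i, p) \<in> extensions C X E \<and> (Y', i', p') \<in> extensions C X E \<and>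
     (\<exists>h. iso_arr C Y Y' h \<and> lcomp C E Y Y' h i = i' \<and> lcomp C Y Y' X p' h = p)}"

definition Ext1 :: "('o, 'm, 'k) lincat \<Rightarrow> 'o \<Rightarrow> 'o \<Rightarrow> ('o \<times> 'm \<times> 'm) set set" where
  "Ext1 C X E = extensions C X E // ext_rel C X E"

definition Ext1_zero :: "('o, 'm, 'k) lincat \<Rightarrow> 'o \<Rightarrow> 'o \<Rightarrow> ('o \<times> 'm \<times> 'm) set" where
  "Ext1_zero C X E =
     {(Y, i, p) \<in> extensions C X E. \<exists>s\<in>arr C X Y. lcomp C X Y X p s = lid C X}"

definition left_perp :: "('o, 'm, 'k) lincat \<Rightarrow> 'o set \<Rightarrow> 'o set" where
  "left_perp C \<E> = {X \<in> lobj C. \<forall>E\<in>\<E>. Ext1 C X E = {Ext1_zero C X E}}"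

definition right_perp :: "('o, 'm, 'k) lincat \<Rightarrow> 'o set \<Rightarrow> 'o set" where
  "right_perp C \<E> = {X \<in> lobj C. \<forall>E\<in>\<E>. Ext1 C E X = {Ext1_zero C E X}}"


section \<open>Linear functors, categories of modules, functor categories\<close>

record ('o, 'm, 'p, 'n) linfun =
  fobj :: "'o \<Rightarrow> 'p"
  farr :: "'o \<Rightarrow> 'o \<Rightarrow> 'm \<Rightarrow> 'n"

definition linear_functor ::
    "'k ring \<Rightarrow> ('o, 'm, 'k) lincat \<Rightarrow> ('p, 'n, 'k) lincat \<Rightarrow> ('o, 'm, 'p, 'n) linfun \<Rightarrow> bool" where
  "linear_functor k C D F \<longleftrightarrow>
     (\<forall>X\<in>lobj C. fobj F X \<in> lobj D) \<and>
     (\<forall>X\<in>lobj C. \<forall>Y\<in>lobj C.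
        is_linear k (lhom C X Y) (lhom D (fobj F X) (fobj F Y)) (farr F X Y)) \<and>
     (\<forall>X\<in>lobj C. farr F X X (lid C X) = lid D (fobj F X)) \<and>
     (\<forall>X\<in>lobj C. \<forall>Y\<in>lobj C. \<forall>Z\<in>lobj C. \<forall>f\<in>arr C X Y. \<forall>g\<in>arr C Y Z.
        farr F X Z (lcomp C X Y Z g f) =
        lcomp D (fobj F X) (fobj F Y) (fobj F Z) (farr F Y Z g) (farr F X Y f))"

definition linfun_id :: "('o, 'm, 'o, 'm) linfun" where
  "linfun_id = \<lparr>fobj = (\<lambda>X. X), farr = (\<lambda>X Y f. f)\<rparr>"

definition linfun_comp ::
    "('p, 'n, 'q, 'l) linfun \<Rightarrow> ('o, 'm, 'p, 'n) linfun \<Rightarrow> ('o, 'm, 'q, 'l) linfun" where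
  "linfun_comp G F = \<lparr>fobj = (\<lambda>X. fobj G (fobj F X)),
     farr = (\<lambda>X Y f. farr G (fobj F X) (fobj F Y) (farr F X Y f))\<rparr>"

text \<open>Left \<open>A\<close>-modules, as a category over \<open>k\<close>. The objects are the modules whose carrier is a
  set of elements of the type \<open>'m\<close>, which plays the role of the universe of small sets. Arrows are
  extensional functions, so that equality of arrows is equality of maps.\<close>

definition Mod_cat ::
    "'k ring \<Rightarrow> ('k, 'a) module \<Rightarrow> (('a, 'm) module, 'm \<Rightarrow> 'm, 'k) lincat" where
  "Mod_cat k A = \<lparr>
     lobj = {M. left_module A M},
     lhom = (\<lambda>M N. \<lparr>
       carrier = {f \<in> carrier M \<rightarrow>\<^sub>E carrier N. is_linear A M N f},
       monoid.mult = undefined, one = undefined,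
       ring.zero = (\<lambda>m\<in>carrier M. \<zero>\<^bsub>N\<^esub>),
       ring.add = (\<lambda>f g. \<lambda>m\<in>carrier M. f m \<oplus>\<^bsub>N\<^esub> g m),
       smult = (\<lambda>x f. \<lambda>m\<in>carrier M. base_smult A N x (f m))\<rparr>),
     lid = (\<lambda>M. \<lambda>m\<in>carrier M. m),
     lcomp = (\<lambda>L M N g f. compose (carrier L) g f)\<rparr>"

abbreviation base_Mod :: "'k ring \<Rightarrow> (('k, 'm) module, 'm \<Rightarrow> 'm, 'k) lincat" where
  "base_Mod k \<equiv> Mod_cat k (self_algebra k)"

text \<open>Linear functors \<open>C \<rightarrow> D\<close> and natural transformations, the latter being families of arrows
  which are extensional on the objects of \<open>C\<close>.\<close>

definition Fun_cat ::
    "'k ring \<Rightarrow> ('o, 'm, 'k) lincat \<Rightarrow> ('p, 'n, 'k) lincat \<Rightarrow>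
     (('o, 'm, 'p, 'n) linfun, 'o \<Rightarrow> 'n, 'k) lincat" where
  "Fun_cat k C D = \<lparr>
     lobj = {F. linear_functor k C D F},
     lhom = (\<lambda>F G. \<lparr>
       carrier = {\<eta> \<in> (\<Pi>\<^sub>E X\<in>lobj C. arr D (fobj F X) (fobj G X)).
         \<forall>X\<in>lobj C. \<forall>Y\<in>lobj C. \<forall>f\<in>arr C X Y.
           lcomp D (fobj F X) (fobj F Y) (fobj G Y) (\<eta> Y) (farr F X Y f) =
           lcomp D (fobj F X) (fobj G X) (fobj G Y) (farr G X Y f) (\<eta> X)},
       monoid.mult = undefined, one = undefined,
       ring.zero = (\<lambda>X\<in>lobj C. zero_arr D (fobj F X) (fobj G X)),
       ring.add = (\<lambda>\<eta> \<theta>. \<lambda>X\<in>lobj C. \<eta> X \<oplus>\<^bsub>lhom D (fobj F X) (fobj G X)\<^esub> \<theta> X),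
       smult = (\<lambda>x \<eta>. \<lambda>X\<in>lobj C. x \<odot>\<^bsub>lhom D (fobj F X) (fobj G X)\<^esub> \<eta> X)\<rparr>),
     lid = (\<lambda>F. \<lambda>X\<in>lobj C. lid D (fobj F X)),
     lcomp = (\<lambda>F G H \<theta> \<eta>. \<lambda>X\<in>lobj C. lcomp D (fobj F X) (fobj G X) (fobj H X) (\<theta> X) (\<eta> X))\<rparr>"

abbreviation QA_Mod ::
    "'k ring \<Rightarrow> ('q, 'h, 'k) lincat \<Rightarrow> ('k, 'a) module \<Rightarrow>
     (('q, 'h, ('a, 'm) module, 'm \<Rightarrow> 'm) linfun, 'q \<Rightarrow> 'm \<Rightarrow> 'm, 'k) lincat" where
  "QA_Mod k Q A \<equiv> Fun_cat k Q (Mod_cat k A)"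

definition forget_A ::
    "('k, 'a) module \<Rightarrow> ('q, 'h, ('a, 'm) module, 'm \<Rightarrow> 'm) linfun \<Rightarrow>
     ('q, 'h, ('k, 'm) module, 'm \<Rightarrow> 'm) linfun" where
  "forget_A A X = \<lparr>fobj = (\<lambda>q. restrict_scalars A (fobj X q)), farr = farr X\<rparr>"

definition exact_objects ::
    "'k ring \<Rightarrow> ('q, 'h, 'k) lincat \<Rightarrow> ('k, 'a) module \<Rightarrow>
     ('q, 'h, ('a, 'm) module, 'm \<Rightarrow> 'm) linfun set" where
  "exact_objects k Q A =
     {X \<in> lobj (QA_Mod k Q A). finite_proj_dim (QA_Mod k Q (self_algebra k)) (forget_A A X)}"


section \<open>Conditions on the base ring and on the indexing category\<close>

text \<open>The base ring, the algebra and the hom modules of the indexing category are taken in the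
  same universe \<open>'u\<close> as the modules, so that all of them are objects of the category of modules
  over the base ring. No closure condition is put on \<open>'u\<close>, which is an arbitrary type and may be
  chosen as large as one likes relative to the given data.\<close>

definition gorenstein :: "'u ring \<Rightarrow> bool" where
  "gorenstein k \<longleftrightarrow>
     cring k \<and> noetherian_ring k \<and> finite_inj_dim (base_Mod k) (self_algebra k)"

definition hom_finite :: "'u ring \<Rightarrow> ('q, 'u, 'u) lincat \<Rightarrow> bool" where
  "hom_finite k Q \<longleftrightarrow> (\<forall>p\<in>lobj Q. \<forall>q\<in>lobj Q.
     fin_gen_module k (lhom Q p q) \<and> lhom Q p q \<in> projectives (base_Mod k))"

definition locally_bounded :: "('q, 'h, 'k) lincat \<Rightarrow> bool" where
  "locally_bounded Q \<longleftrightarrow> (\<forall>q\<in>lobj Q.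
     finite {p \<in> lobj Q. arr Q p q \<noteq> {zero_arr Q p q}} \<and>
     finite {r \<in> lobj Q. arr Q q r \<noteq> {zero_arr Q q r}})"

definition linear_autoequivalence ::
    "'k ring \<Rightarrow> ('q, 'h, 'k) lincat \<Rightarrow> ('q, 'h, 'q, 'h) linfun \<Rightarrow> bool" where
  "linear_autoequivalence k Q S \<longleftrightarrow> linear_functor k Q Q S \<and>
     (\<exists>T. linear_functor k Q Q T \<and>
        isomorphic (Fun_cat k Q Q) (linfun_comp S T) linfun_id \<and>
        isomorphic (Fun_cat k Q Q) (linfun_comp T S) linfun_id)"

text \<open>Naturality of \<open>\<sigma>\<^sub>p\<^sub>q : Q(p,q) \<cong> Hom\<^sub>k(Q(q, S p), k)\<close>: for \<open>f : p' \<rightarrow> p\<close> and \<open>g : q \<rightarrow> q'\<close>, the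
  functional assigned to \<open>g \<circ> h \<circ> f\<close> sends \<open>u : q' \<rightarrow> S p'\<close> to \<open>\<sigma>\<^sub>p\<^sub>q h (S f \<circ> u \<circ> g)\<close>.\<close>

definition has_serre_functor :: "'u ring \<Rightarrow> ('q, 'u, 'u) lincat \<Rightarrow> bool" where
  "has_serre_functor k Q \<longleftrightarrow>
     (\<exists>(S::('q, 'u, 'q, 'u) linfun) (\<sigma>::'q \<Rightarrow> 'q \<Rightarrow> 'u \<Rightarrow> 'u \<Rightarrow> 'u).
        linear_autoequivalence k Q S \<and>
        (\<forall>p\<in>lobj Q. \<forall>q\<in>lobj Q.
           let dual = lhom (base_Mod k) (lhom Q q (fobj S p)) (self_algebra k) in
             is_linear k (lhom Q p q) dual (\<sigma> p q) \<and>
             bij_betw (\<sigma> p q) (carrier (lhom Q p q)) (carrier dual)) \<and>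
        (\<forall>p\<in>lobj Q. \<forall>p'\<in>lobj Q. \<forall>q\<in>lobj Q. \<forall>q'\<in>lobj Q.
           \<forall>f\<in>arr Q p' p. \<forall>g\<in>arr Q q q'. \<forall>h\<in>arr Q p q. \<forall>u\<in>arr Q q' (fobj S p').
             \<sigma> p' q' (lcomp Q p' q q' g (lcomp Q p' p q h f)) u =
             \<sigma> p q h (lcomp Q q (fobj S p') (fobj S p) (farr S p' p f)
                       (lcomp Q q q' (fobj S p') u g))))"

definition retraction_property :: "'k ring \<Rightarrow> ('q, 'h, 'k) lincat \<Rightarrow> bool" where
  "retraction_property k Q \<longleftrightarrow> (\<forall>q\<in>lobj Q. \<exists>r.
     is_linear k (lhom Q q q) (self_algebra k) r \<and>
     (\<forall>x\<in>carrier k. r (x \<odot>\<^bsub>lhom Q q q\<^esub> lid Q q) = x))"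


section \<open>Abelian model structures\<close>

record ('o, 'm) model_str =
  cof :: "'o \<Rightarrow> 'o \<Rightarrow> 'm set"
  fib :: "'o \<Rightarrow> 'o \<Rightarrow> 'm set"
  weq :: "'o \<Rightarrow> 'o \<Rightarrow> 'm set"

definition wide_subcategory ::
    "('o, 'm, 'k) lincat \<Rightarrow> ('o \<Rightarrow> 'o \<Rightarrow> 'm set) \<Rightarrow> bool" where
  "wide_subcategory C W \<longleftrightarrow>
     (\<forall>X\<in>lobj C. \<forall>Y\<in>lobj C. W X Y \<subseteq> arr C X Y) \<and>
     (\<forall>X\<in>lobj C. lid C X \<in> W X X) \<and>
     (\<forall>X\<in>lobj C. \<forall>Y\<in>lobj C. \<forall>Z\<in>lobj C. \<forall>f\<in>W X Y. \<forall>g\<in>W Y Z. lcomp C X Y Z g f \<in> W X Z)"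

definition two_out_of_three ::
    "('o, 'm, 'k) lincat \<Rightarrow> ('o \<Rightarrow> 'o \<Rightarrow> 'm set) \<Rightarrow> bool" where
  "two_out_of_three C W \<longleftrightarrow>
     (\<forall>X\<in>lobj C. \<forall>Y\<in>lobj C. \<forall>Z\<in>lobj C. \<forall>f\<in>arr C X Y. \<forall>g\<in>arr C Y Z.
        (f \<in> W X Y \<and> g \<in> W Y Z \<longrightarrow> lcomp C X Y Z g f \<in> W X Z) \<and>
        (f \<in> W X Y \<and> lcomp C X Y Z g f \<in> W X Z \<longrightarrow> g \<in> W Y Z) \<and>
        (g \<in> W Y Z \<and> lcomp C X Y Z g f \<in> W X Z \<longrightarrow> f \<in> W X Y))"

definition retract_of ::
    "('o, 'm, 'k) lincat \<Rightarrow> 'o \<Rightarrow> 'o \<Rightarrow> 'm \<Rightarrow> 'o \<Rightarrow> 'o \<Rightarrow> 'm \<Rightarrow> bool" where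
  "retract_of C X Y f X' Y' g \<longleftrightarrow>
     (\<exists>i\<in>arr C X X'. \<exists>r\<in>arr C X' X. \<exists>j\<in>arr C Y Y'. \<exists>s\<in>arr C Y' Y.
        lcomp C X X' X r i = lid C X \<and> lcomp C Y Y' Y s j = lid C Y \<and>
        lcomp C X X' Y' g i = lcomp C X Y Y' j f \<and>
        lcomp C X' X Y f r = lcomp C X' Y' Y s g)"

definition closed_under_retracts ::
    "('o, 'm, 'k) lincat \<Rightarrow> ('o \<Rightarrow> 'o \<Rightarrow> 'm set) \<Rightarrow> bool" where
  "closed_under_retracts C W \<longleftrightarrow>
     (\<forall>X\<in>lobj C. \<forall>Y\<in>lobj C. \<forall>X'\<in>lobj C. \<forall>Y'\<in>lobj C. \<forall>f\<in>arr C X Y. \<forall>g\<in>W X' Y'.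
        retract_of C X Y f X' Y' g \<longrightarrow> f \<in> W X Y)"

definition has_lifting ::
    "('o, 'm, 'k) lincat \<Rightarrow> ('o \<Rightarrow> 'o \<Rightarrow> 'm set) \<Rightarrow> ('o \<Rightarrow> 'o \<Rightarrow> 'm set) \<Rightarrow> bool" where
  "has_lifting C L R \<longleftrightarrow>
     (\<forall>A\<in>lobj C. \<forall>B\<in>lobj C. \<forall>X\<in>lobj C. \<forall>Y\<in>lobj C. \<forall>i\<in>L A B. \<forall>p\<in>R X Y.
        \<forall>u\<in>arr C A X. \<forall>v\<in>arr C B Y. lcomp C A X Y p u = lcomp C A B Y v i \<longrightarrow>
          (\<exists>h\<in>arr C B X. lcomp C A B X h i = u \<and> lcomp C B X Y p h = v))"

definition has_factorizations ::
    "('o, 'm, 'k) lincat \<Rightarrow> ('o \<Rightarrow> 'o \<Rightarrow> 'm set) \<Rightarrow> ('o \<Rightarrow> 'o \<Rightarrow> 'm set) \<Rightarrow> bool" where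
  "has_factorizations C L R \<longleftrightarrow>
     (\<forall>X\<in>lobj C. \<forall>Y\<in>lobj C. \<forall>f\<in>arr C X Y.
        \<exists>Z\<in>lobj C. \<exists>i\<in>L X Z. \<exists>p\<in>R Z Y. f = lcomp C X Z Y p i)"

definition triv_cof :: "('o, 'm) model_str \<Rightarrow> 'o \<Rightarrow> 'o \<Rightarrow> 'm set" where
  "triv_cof M X Y = cof M X Y \<inter> weq M X Y"

definition triv_fib :: "('o, 'm) model_str \<Rightarrow> 'o \<Rightarrow> 'o \<Rightarrow> 'm set" where
  "triv_fib M X Y = fib M X Y \<inter> weq M X Y"

definition model_structure :: "('o, 'm, 'k) lincat \<Rightarrow> ('o, 'm) model_str \<Rightarrow> bool" where
  "model_structure C M \<longleftrightarrow>
     wide_subcategory C (cof M) \<and> wide_subcategory C (fib M) \<and> wide_subcategory C (weq M) \<and>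
     two_out_of_three C (weq M) \<and>
     closed_under_retracts C (cof M) \<and> closed_under_retracts C (fib M) \<and>
     closed_under_retracts C (weq M) \<and>
     has_lifting C (triv_cof M) (fib M) \<and> has_lifting C (cof M) (triv_fib M) \<and>
     has_factorizations C (triv_cof M) (fib M) \<and> has_factorizations C (cof M) (triv_fib M)"

definition cofibrant_objects :: "('o, 'm, 'k) lincat \<Rightarrow> ('o, 'm) model_str \<Rightarrow> 'o set" where
  "cofibrant_objects C M = {X \<in> lobj C. \<exists>Z f. is_zero C Z \<and> f \<in> cof M Z X}"

definition fibrant_objects :: "('o, 'm, 'k) lincat \<Rightarrow> ('o, 'm) model_str \<Rightarrow> 'o set" where
  "fibrant_objects C M = {X \<in> lobj C. \<exists>Z f. is_zero C Z \<and> f \<in> fib M X Z}"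

text \<open>Weak equivalence of objects is the equivalence relation generated by the existence of a
  weak equivalence (zigzags).\<close>

definition trivial_objects :: "('o, 'm, 'k) lincat \<Rightarrow> ('o, 'm) model_str \<Rightarrow> 'o set" where
  "trivial_objects C M = {X \<in> lobj C. \<exists>Z. is_zero C Z \<and>
     equivclp (\<lambda>X Y. X \<in> lobj C \<and> Y \<in> lobj C \<and> weq M X Y \<noteq> {}) X Z}"

definition abelian_model_structure :: "('o, 'm, 'k) lincat \<Rightarrow> ('o, 'm) model_str \<Rightarrow> bool" where
  "abelian_model_structure C M \<longleftrightarrow> model_structure C M \<and>
     (\<forall>X\<in>lobj C. \<forall>Y\<in>lobj C. \<forall>f\<in>arr C X Y.
        (f \<in> cof M X Y \<longleftrightarrow> mono_with_coker_in C (cofibrant_objects C M) X Y f) \<and>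
        (f \<in> triv_cof M X Y \<longleftrightarrow>
           mono_with_coker_in C (cofibrant_objects C M \<inter> trivial_objects C M) X Y f) \<and>
        (f \<in> fib M X Y \<longleftrightarrow> epi_with_ker_in C (fibrant_objects C M) X Y f) \<and>
        (f \<in> triv_fib M X Y \<longleftrightarrow>
           epi_with_ker_in C (fibrant_objects C M \<inter> trivial_objects C M) X Y f))"

definition projective_model_structure ::
    "('o, 'm, 'k) lincat \<Rightarrow> 'o set \<Rightarrow> ('o, 'm) model_str \<Rightarrow> bool" where
  "projective_model_structure C \<E> M \<longleftrightarrow> abelian_model_structure C M \<and>
     cofibrant_objects C M = left_perp C \<E> \<and> trivial_objects C M = \<E> \<and>
     fibrant_objects C M = lobj C"

definition injective_model_structure ::
    "('o, 'm, 'k) lincat \<Rightarrow> 'o set \<Rightarrow> ('o, 'm) model_str \<Rightarrow> bool" where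
  "injective_model_structure C \<E> M \<longleftrightarrow> abelian_model_structure C M \<and>
     fibrant_objects C M = right_perp C \<E> \<and> trivial_objects C M = \<E> \<and>
     cofibrant_objects C M = lobj C"

end

theory Submission
  imports Defs
begin

text \<open>In an abelian model structure with all objects fibrant, lifting and retracts identify the
  projective objects with the trivially cofibrant ones, so factoring a weak equivalence gives
  condition (ii). For the converse, let \<open>i = p j\<close> be monic with trivial cokernel, factored into a
  cofibration followed by a trivial fibration. The induced epimorphism \<open>Coker j \<rightarrow> Coker i\<close> has the
  same kernel as \<open>p\<close>, hence is a trivial fibration. So \<open>Coker j\<close> is trivial, and \<open>j\<close> and
  therefore \<open>i\<close> are weak equivalences. The injective case is this argument in the opposite
  category.\<close>

section \<open>Normal categories\<close>

text \<open>The two structures become comparable because condition (i) names only the class \<E>,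
  the trivial objects of both: each class of weak equivalences is shown to consist of the arrows in
  (i). A monic \<open>i\<close> as in (i) need not be a cofibration, since its cokernel is trivial
  but perhaps not cofibrant. This is why it is factored again: the cokernel of \<open>j\<close> is
  cofibrant by construction, and only its triviality is left to prove. Triviality means a zigzag of
  weak equivalences to zero, so it is carried from one cokernel to the other by lengthening a zigzag
  with the induced epimorphism. The comparison of the two kernels is an instance of the snake lemma.
  A pullback over zero is a product, so pullbacks may be missing for the same reason as biproducts.
  Kernels, which are subsets, and cokernels, realised on coset representatives, always fit into the
  universe; the diagram argument is therefore built from these and from cancellation.\<close>

text \<open>The universe may be too small for the functor category to have binary biproducts, so it is
  not assumed to be abelian; zero arrows and normality of monomorphisms and epimorphisms suffice.\<close>

locale normal_category =
  fixes C :: "('o, 'm, 'k) lincat"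
  assumes id_arr: "X \<in> lobj C \<Longrightarrow> lid C X \<in> arr C X X"
    and comp_arr: "\<lbrakk>X \<in> lobj C; Y \<in> lobj C; Z \<in> lobj C; f \<in> arr C X Y; g \<in> arr C Y Z\<rbrakk> \<Longrightarrow>
      lcomp C X Y Z g f \<in> arr C X Z"
    and id_comp: "\<lbrakk>X \<in> lobj C; Y \<in> lobj C; f \<in> arr C X Y\<rbrakk> \<Longrightarrow> lcomp C X Y Y (lid C Y) f = f"
    and comp_id: "\<lbrakk>X \<in> lobj C; Y \<in> lobj C; f \<in> arr C X Y\<rbrakk> \<Longrightarrow> lcomp C X X Y f (lid C X) = f"
    and comp_assoc:
      "\<lbrakk>W \<in> lobj C; X \<in> lobj C; Y \<in> lobj C; Z \<in> lobj C;
        f \<in> arr C W X; g \<in> arr C X Y; h \<in> arr C Y Z\<rbrakk> \<Longrightarrow>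
       lcomp C W Y Z h (lcomp C W X Y g f) = lcomp C W X Z (lcomp C X Y Z h g) f"
    and zero_arr_arr: "\<lbrakk>X \<in> lobj C; Y \<in> lobj C\<rbrakk> \<Longrightarrow> zero_arr C X Y \<in> arr C X Y"
    and comp_zero: "\<lbrakk>X \<in> lobj C; Y \<in> lobj C; Z \<in> lobj C; g \<in> arr C Y Z\<rbrakk> \<Longrightarrow>
      lcomp C X Y Z g (zero_arr C X Y) = zero_arr C X Z"
    and zero_comp: "\<lbrakk>X \<in> lobj C; Y \<in> lobj C; Z \<in> lobj C; f \<in> arr C X Y\<rbrakk> \<Longrightarrow>
      lcomp C X Y Z (zero_arr C Y Z) f = zero_arr C X Z"
    and ex_zero: "\<exists>Z. is_zero C Z"
    and monicI: "\<lbrakk>X \<in> lobj C; Y \<in> lobj C; f \<in> arr C X Y;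
        \<And>W g. \<lbrakk>W \<in> lobj C; g \<in> arr C W X; lcomp C W X Y f g = zero_arr C W Y\<rbrakk> \<Longrightarrow>
          g = zero_arr C W X\<rbrakk> \<Longrightarrow> monic C X Y f"
    and epicI: "\<lbrakk>X \<in> lobj C; Y \<in> lobj C; f \<in> arr C X Y;
        \<And>Z g. \<lbrakk>Z \<in> lobj C; g \<in> arr C Y Z; lcomp C X Y Z g f = zero_arr C X Z\<rbrakk> \<Longrightarrow>
          g = zero_arr C Y Z\<rbrakk> \<Longrightarrow> epic C X Y f"
    and monic_normal: "\<lbrakk>X \<in> lobj C; Y \<in> lobj C; monic C X Y f\<rbrakk> \<Longrightarrow>
      \<exists>Z c. is_cokernel C X Y f Z c \<and> is_kernel C Y Z c X f"
    and epic_normal: "\<lbrakk>X \<in> lobj C; Y \<in> lobj C; epic C X Y f\<rbrakk> \<Longrightarrow>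
      \<exists>K j. is_kernel C X Y f K j \<and> is_cokernel C K X j Y f"
begin

text \<open>Normality gives only some cokernel \<open>c'\<close> that has \<open>f\<close> as a
  kernel. It factors through the given \<open>c\<close>, so an arrow killed by \<open>c\<close> is
  killed by \<open>c'\<close> and lifts uniquely along \<open>f\<close>.\<close>

lemma monic_is_kernel_of_cokernel:
  assumes "X \<in> lobj C" "Y \<in> lobj C" "monic C X Y f" and c: "is_cokernel C X Y f Z c"
  shows "is_kernel C Y Z c X f"
proof -
  obtain Z' c' where c': "is_cokernel C X Y f Z' c'" and k': "is_kernel C Y Z' c' X f"
    using monic_normal[OF assms(1-3)] by blast
  obtain h where h: "h \<in> arr C Z Z'" "lcomp C Y Z Z' h c = c'"
    using c c' unfolding is_cokernel_def by metis
  have Z: "Z \<in> lobj C" "Z' \<in> lobj C" "c \<in> arr C Y Z" "c' \<in> arr C Y Z'"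
    using c c' unfolding is_cokernel_def by auto
  have "\<exists>!m. m \<in> arr C W X \<and> lcomp C W X Y f m = g"
    if W: "W \<in> lobj C" "g \<in> arr C W Y" "lcomp C W Y Z c g = zero_arr C W Z" for W g
  proof -
    have "lcomp C W Y Z' c' g = lcomp C W Z Z' h (lcomp C W Y Z c g)"
      using comp_assoc[of W Y Z Z' g c h] h Z W assms by simp
    also have "\<dots> = zero_arr C W Z'" using W comp_zero Z h by simp
    finally show ?thesis using k' W unfolding is_kernel_def by blast
  qed
  with c assms(1,2) show ?thesis unfolding is_kernel_def is_cokernel_def by blast
qed

text \<open>Dually, the kernel \<open>j'\<close> given by normality factors through
  \<open>j\<close>, so an arrow that kills \<open>j\<close> kills \<open>j'\<close> and descends
  uniquely along \<open>f\<close>.\<close>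

lemma epic_is_cokernel_of_kernel:
  assumes "X \<in> lobj C" "Y \<in> lobj C" "epic C X Y f" and k: "is_kernel C X Y f K j"
  shows "is_cokernel C K X j Y f"
proof -
  obtain K' j' where k': "is_kernel C X Y f K' j'" and c': "is_cokernel C K' X j' Y f"
    using epic_normal[OF assms(1-3)] by blast
  obtain h where h: "h \<in> arr C K' K" "lcomp C K' K X j h = j'"
    using k k' unfolding is_kernel_def by metis
  have Z: "K \<in> lobj C" "K' \<in> lobj C" "j \<in> arr C K X" "j' \<in> arr C K' X"
    using k k' unfolding is_kernel_def by auto
  have "\<exists>!m. m \<in> arr C Y W \<and> lcomp C X Y W m f = g"
    if W: "W \<in> lobj C" "g \<in> arr C X W" "lcomp C K X W g j = zero_arr C K W" for W g
  proof -
    have "lcomp C K' X W g j' = lcomp C K' K W (lcomp C K X W g j) h"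
      using comp_assoc[of K' K X W h j g] h Z W assms by simp
    also have "\<dots> = zero_arr C K' W" using W zero_comp Z h by simp
    finally show ?thesis using c' W unfolding is_cokernel_def by blast
  qed
  with k assms(1,2) show ?thesis unfolding is_kernel_def is_cokernel_def by blast
qed

text \<open>An arrow \<open>g\<close> with \<open>g c = 0\<close> and the zero arrow both factor the
  zero arrow through \<open>c\<close>, so uniqueness identifies them; \<open>epicI\<close> asks for
  this test against zero.\<close>

lemma cokernel_epic:
  assumes "is_cokernel C X Y f Z c"
  shows "epic C Y Z c"
proof (rule epicI)
  note c = assms[unfolded is_cokernel_def]
  show "Y \<in> lobj C" "Z \<in> lobj C" "c \<in> arr C Y Z" using c by auto
  fix W g assume W: "W \<in> lobj C" "g \<in> arr C Z W" "lcomp C Y Z W g c = zero_arr C Y W"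
  have "lcomp C Y Z W (zero_arr C Z W) c = zero_arr C Y W" using c W zero_comp by blast
  moreover have "lcomp C X Y W (zero_arr C Y W) f = zero_arr C X W" using c W zero_comp by blast
  ultimately show "g = zero_arr C Z W" using c W zero_arr_arr by metis
qed

lemma zero_unique_from: "is_zero C Z \<Longrightarrow> X \<in> lobj C \<Longrightarrow> f \<in> arr C Z X \<Longrightarrow> g \<in> arr C Z X \<Longrightarrow> f = g"
  unfolding is_zero_def by blast

lemma zero_unique_to: "is_zero C Z \<Longrightarrow> X \<in> lobj C \<Longrightarrow> f \<in> arr C X Z \<Longrightarrow> g \<in> arr C X Z \<Longrightarrow> f = g"
  unfolding is_zero_def by blast

lemma monic_from_zero: "is_zero C Z \<Longrightarrow> f \<in> arr C Z X \<Longrightarrow> monic C Z X f"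
  unfolding monic_def by (blast intro: zero_unique_to)

text \<open>Translates between objects and arrows: the arrow from zero to \<open>X\<close> is a
  (trivial) cofibration as soon as \<open>X\<close>, being its cokernel, is (trivially)
  cofibrant.\<close>

lemma cokernel_from_zero:
  assumes "is_zero C Z" "X \<in> lobj C" "f \<in> arr C Z X"
  shows "is_cokernel C Z X f X (lid C X)"
proof -
  have Z: "Z \<in> lobj C" using assms unfolding is_zero_def by blast
  have "lcomp C Z X X (lid C X) f = zero_arr C Z X"
    using assms Z zero_unique_from[OF assms(1,2)] id_comp zero_arr_arr by simp
  moreover have "\<exists>!h. h \<in> arr C X W \<and> lcomp C X X W h (lid C X) = g"
    if "W \<in> lobj C" "g \<in> arr C X W" for W g
    using that assms(2) comp_id by metis
  ultimately show ?thesis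
    unfolding is_cokernel_def using assms Z id_arr by blast
qed

text \<open>This is the snake lemma for the rows \<open>X -> W -> D\<close> and
  \<open>X -> Y -> E\<close>, joined by the identity of \<open>X\<close>, by \<open>p\<close> and by
  the induced \<open>d\<close>: as the identity is invertible, \<open>p\<close> and \<open>d\<close>
  share their kernel. To test \<open>c m\<close> as a kernel of \<open>d\<close> directly, arrows
  into \<open>D\<close> would have to be lifted along \<open>c\<close>, which calls for a pullback.
  Instead \<open>d\<close> is shown to be a cokernel of the monic \<open>c m\<close>, which concerns
  arrows out of \<open>D\<close>, and normality turns this around.\<close>

lemma cokernel_of_factorization:
  assumes obj: "X \<in> lobj C" "W \<in> lobj C" "Y \<in> lobj C"
    and j: "j \<in> arr C X W" and cj: "is_cokernel C X W j D c" and mj: "monic C X W j"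
    and p: "epic C W Y p" and kp: "is_kernel C W Y p K m"
    and i: "i = lcomp C X W Y p j" "monic C X Y i" and ci: "is_cokernel C X Y i E e"
  shows "\<exists>d. epic C D E d \<and> is_kernel C D E d K (lcomp C K W D c m)"
proof -
  have pa: "p \<in> arr C W Y" using p unfolding epic_def by blast
  have D: "D \<in> lobj C" "c \<in> arr C W D" "lcomp C X W D c j = zero_arr C X D"
    and Dh: "\<And>V g. \<lbrakk>V \<in> lobj C; g \<in> arr C W V; lcomp C X W V g j = zero_arr C X V\<rbrakk> \<Longrightarrow>
      \<exists>h\<in>arr C D V. lcomp C W D V h c = g"
    using cj unfolding is_cokernel_def by blast+
  have E: "E \<in> lobj C" "e \<in> arr C Y E" "lcomp C X Y E e i = zero_arr C X E"
    and Eh: "\<And>V g. \<lbrakk>V \<in> lobj C; g \<in> arr C Y V; lcomp C X Y V g i = zero_arr C X V\<rbrakk> \<Longrightarrow>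
      \<exists>h\<in>arr C E V. lcomp C Y E V h e = g"
    using ci unfolding is_cokernel_def by blast+
  have K: "K \<in> lobj C" "m \<in> arr C K W" "lcomp C K W Y p m = zero_arr C K Y"
    using kp unfolding is_kernel_def by blast+
  \<comment> \<open>A kernel can be cancelled: \<open>g\<close> and the zero arrow are both
    factorizations of the zero arrow through \<open>m\<close>.\<close>
  have Kmono: "g = zero_arr C V K" if "V \<in> lobj C" "g \<in> arr C V K"
    "lcomp C V K W m g = zero_arr C V W" for V g
  proof -
    have "lcomp C V W Y p (zero_arr C V W) = zero_arr C V Y" using that obj pa comp_zero by blast
    then have "\<exists>!h. h \<in> arr C V K \<and> lcomp C V K W m h = zero_arr C V W"
      using kp that zero_arr_arr[of V W] obj unfolding is_kernel_def by blast
    moreover have "lcomp C V K W m (zero_arr C V K) = zero_arr C V W"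
      using that K obj comp_zero by blast
    ultimately show ?thesis using that zero_arr_arr[of V K] K by blast
  qed
  have "lcomp C X W E (lcomp C W Y E e p) j = zero_arr C X E"
    using E i comp_assoc[of X W Y E j p e] obj j pa by simp
  then obtain d where d: "d \<in> arr C D E" "lcomp C W D E d c = lcomp C W Y E e p"
    using Dh[of E "lcomp C W Y E e p"] comp_arr[of W Y E p e] E obj pa by blast
  define n where "n = lcomp C K W D c m"
  have n: "n \<in> arr C K D" unfolding n_def using comp_arr K D obj by blast
  \<comment> \<open>Cancellation passes from the composite \<open>d c = e p\<close> of the epics
    \<open>p\<close> and \<open>e\<close> to its last factor \<open>d\<close>.\<close>
  have epd: "epic C D E d"
  proof (rule epicI[OF D(1) E(1) d(1)])
    fix V g assume V: "V \<in> lobj C" "g \<in> arr C E V" "lcomp C D E V g d = zero_arr C D V"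
    have "lcomp C W Y V (lcomp C Y E V g e) p = lcomp C W E V g (lcomp C W Y E e p)"
      using comp_assoc[of W Y E V p e g] V obj E pa by simp
    also have "\<dots> = lcomp C W D V (lcomp C D E V g d) c"
      using comp_assoc[of W D E V c d g] V obj E D d by simp
    also have "\<dots> = zero_arr C W V" using V zero_comp obj D by simp
    also have "\<dots> = lcomp C W Y V (zero_arr C Y V) p" using V zero_comp obj pa by simp
    finally have "lcomp C Y E V g e = zero_arr C Y V"
      using p V obj E comp_arr[of Y E V e g] zero_arr_arr[of Y V] unfolding epic_def by blast
    also have "\<dots> = lcomp C Y E V (zero_arr C E V) e" using zero_comp V obj E by simp
    finally show "g = zero_arr C E V"
      using cokernel_epic[OF ci] V zero_arr_arr[of E V] E unfolding epic_def by blast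
  qed
  \<comment> \<open>If \<open>c m g = 0\<close>, then \<open>m g\<close> factors through
    \<open>j\<close>, the kernel of \<open>c\<close>, as \<open>m g = j y\<close>. Applying
    \<open>p\<close> gives \<open>i y = p m g = 0\<close>, so \<open>y = 0\<close> because
    \<open>i\<close> is monic.\<close>
  have mn: "monic C K D n"
  proof (rule monicI[OF K(1) D(1) n])
    fix V g assume V: "V \<in> lobj C" "g \<in> arr C V K" "lcomp C V K D n g = zero_arr C V D"
    have mg: "lcomp C V K W m g \<in> arr C V W" using V K obj comp_arr by blast
    have "lcomp C V W D c (lcomp C V K W m g) = zero_arr C V D"
      using V(3) unfolding n_def using comp_assoc[of V K W D g m c] V K D obj by simp
    then obtain y where y: "y \<in> arr C V X" "lcomp C V X W j y = lcomp C V K W m g"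
      using monic_is_kernel_of_cokernel[OF obj(1,2) mj cj] V mg unfolding is_kernel_def by blast
    have "lcomp C V X Y i y = lcomp C V W Y p (lcomp C V X W j y)"
      unfolding i(1) using comp_assoc[of V X W Y y j p] y V obj j pa by simp
    also have "\<dots> = lcomp C V K Y (lcomp C K W Y p m) g"
      unfolding y(2) using comp_assoc[of V K W Y g m p] V K obj pa by simp
    also have "\<dots> = zero_arr C V Y" using K V obj zero_comp by simp
    also have "\<dots> = lcomp C V X Y i (zero_arr C V X)"
      using comp_zero[of V X Y i] V obj i(2) unfolding monic_def by simp
    finally have "y = zero_arr C V X"
      using i(2) V y(1) zero_arr_arr[of V X] obj unfolding monic_def by blast
    then have "lcomp C V K W m g = zero_arr C V W"
      using y(2) comp_zero[of V X W j] V obj j by simp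
    then show "g = zero_arr C V K" using Kmono V by blast
  qed
  have "is_cokernel C K D n E d"
  proof -
    have "lcomp C K D E d n = lcomp C K W E (lcomp C W D E d c) m"
      unfolding n_def using comp_assoc[of K W D E m c d] K D E d obj by simp
    also have "\<dots> = lcomp C K Y E e (lcomp C K W Y p m)"
      using comp_assoc[of K W Y E m p e] d K E obj pa by simp
    also have "\<dots> = zero_arr C K E" using K E obj comp_zero by simp
    finally have z: "lcomp C K D E d n = zero_arr C K E" .
    \<comment> \<open>An arrow \<open>g\<close> with \<open>g c m = 0\<close> descends twice:
      \<open>g c\<close> descends along \<open>p\<close>, the cokernel of \<open>m\<close>, to
      \<open>h1\<close>; then \<open>h1\<close> descends along \<open>e\<close>, because
      \<open>h1 i = g c j = 0\<close>. The result is compared with \<open>g\<close> after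
      composition with the epic \<open>c\<close>.\<close>
    have "\<exists>!h. h \<in> arr C E V \<and> lcomp C D E V h d = g"
      if V: "V \<in> lobj C" "g \<in> arr C D V" "lcomp C K D V g n = zero_arr C K V" for V g
    proof -
      have gc: "lcomp C W D V g c \<in> arr C W V" using V D obj comp_arr by blast
      have "lcomp C K W V (lcomp C W D V g c) m = zero_arr C K V"
        using V(3) unfolding n_def using comp_assoc[of K W D V m c g] K D V obj by simp
      then obtain h1 where h1: "h1 \<in> arr C Y V" "lcomp C W Y V h1 p = lcomp C W D V g c"
        using epic_is_cokernel_of_kernel[OF obj(2,3) p kp] V gc unfolding is_cokernel_def by blast
      have "lcomp C X Y V h1 i = lcomp C X W V (lcomp C W Y V h1 p) j"
        unfolding i(1) using comp_assoc[of X W Y V j p h1] h1 V obj j pa by simp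
      also have "\<dots> = lcomp C X D V g (lcomp C X W D c j)"
        unfolding h1(2) using comp_assoc[of X W D V j c g] V obj j D by simp
      also have "\<dots> = zero_arr C X V" using D V obj comp_zero by simp
      finally obtain h2 where h2: "h2 \<in> arr C E V" "lcomp C Y E V h2 e = h1"
        using Eh h1 V by blast
      have "lcomp C W D V (lcomp C D E V h2 d) c = lcomp C W E V h2 (lcomp C W Y E e p)"
        using comp_assoc[of W D E V c d h2] d h2 D E V obj by simp
      also have "\<dots> = lcomp C W D V g c"
        using comp_assoc[of W Y E V p e h2] h1 h2 E V obj pa by simp
      finally have "lcomp C D E V h2 d = g"
        using cokernel_epic[OF cj] V comp_arr[of D E V d h2] D E d h2 unfolding epic_def by blast
      then show ?thesis using h2(1) epd V unfolding epic_def by blast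
    qed
    then show ?thesis unfolding is_cokernel_def using K D E n d z by blast
  qed
  then have "is_kernel C D E d K n" using monic_is_kernel_of_cokernel mn K D by blast
  then show ?thesis using epd unfolding n_def by blast
qed

end


section \<open>Abelian model structures with all objects fibrant\<close>

locale all_fibrant_model = normal_category C
  for C :: "('o, 'm, 'k) lincat" +
  fixes M :: "('o, 'm) model_str"
  assumes abelian_model: "abelian_model_structure C M"
    and all_fibrant: "fibrant_objects C M = lobj C"
begin

section \<open>The axioms of an abelian model structure when every object is fibrant\<close>

lemma model: "model_structure C M"
  using abelian_model unfolding abelian_model_structure_def by blast

lemma wide:
  "wide_subcategory C (cof M)" "wide_subcategory C (fib M)" "wide_subcategory C (weq M)"
  using model unfolding model_structure_def by blast+

lemma weq_arr: "X \<in> lobj C \<Longrightarrow> Y \<in> lobj C \<Longrightarrow> weq M X Y \<subseteq> arr C X Y"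
  using wide(3) unfolding wide_subcategory_def by blast

lemma cof_arr: "X \<in> lobj C \<Longrightarrow> Y \<in> lobj C \<Longrightarrow> cof M X Y \<subseteq> arr C X Y"
  using wide(1) unfolding wide_subcategory_def by blast

lemma fib_arr: "X \<in> lobj C \<Longrightarrow> Y \<in> lobj C \<Longrightarrow> fib M X Y \<subseteq> arr C X Y"
  using wide(2) unfolding wide_subcategory_def by blast

lemma weq_comp:
  "\<lbrakk>X \<in> lobj C; Y \<in> lobj C; Z \<in> lobj C; f \<in> weq M X Y; g \<in> weq M Y Z\<rbrakk> \<Longrightarrow>
   lcomp C X Y Z g f \<in> weq M X Z"
  using wide(3) unfolding wide_subcategory_def by blast

lemma weq_cancel_right:
  "\<lbrakk>X \<in> lobj C; Y \<in> lobj C; Z \<in> lobj C; f \<in> weq M X Y; g \<in> arr C Y Z;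
    lcomp C X Y Z g f \<in> weq M X Z\<rbrakk> \<Longrightarrow> g \<in> weq M Y Z"
  using model weq_arr[of X Y] unfolding model_structure_def two_out_of_three_def by blast

lemma trivial_obj: "X \<in> trivial_objects C M \<Longrightarrow> X \<in> lobj C"
  unfolding trivial_objects_def by blast

text \<open>A weak equivalence into a trivial object lengthens the zigzag of that object by one
  step.\<close>

lemma trivial_objects_weq:
  assumes "X \<in> lobj C" "Y \<in> trivial_objects C M" "f \<in> weq M X Y"
  shows "X \<in> trivial_objects C M"
proof -
  have Y: "Y \<in> lobj C" using assms(2) trivial_obj by blast
  then have "equivclp (\<lambda>X Y. X \<in> lobj C \<and> Y \<in> lobj C \<and> weq M X Y \<noteq> {}) X Y"
    using assms by (intro r_into_equivclp) blast
  then show ?thesis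
    using assms(1,2) unfolding trivial_objects_def by (blast intro: equivclp_trans)
qed

lemma cof_iff:
  "\<lbrakk>X \<in> lobj C; Y \<in> lobj C; f \<in> arr C X Y\<rbrakk> \<Longrightarrow>
   f \<in> cof M X Y \<longleftrightarrow> mono_with_coker_in C (cofibrant_objects C M) X Y f"
  using abelian_model unfolding abelian_model_structure_def by blast

lemma triv_cof_iff:
  "\<lbrakk>X \<in> lobj C; Y \<in> lobj C; f \<in> arr C X Y\<rbrakk> \<Longrightarrow>
   f \<in> triv_cof M X Y \<longleftrightarrow>
     mono_with_coker_in C (cofibrant_objects C M \<inter> trivial_objects C M) X Y f"
  using abelian_model unfolding abelian_model_structure_def by blast

text \<open>With every object fibrant, the condition on the kernel asks only that a kernel exist,
  and normality of epimorphisms provides one.\<close>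

lemma fib_iff:
  assumes "X \<in> lobj C" "Y \<in> lobj C" "f \<in> arr C X Y"
  shows "f \<in> fib M X Y \<longleftrightarrow> epic C X Y f"
proof -
  have "f \<in> fib M X Y \<longleftrightarrow> epi_with_ker_in C (lobj C) X Y f"
    using abelian_model assms unfolding abelian_model_structure_def all_fibrant by blast
  then show ?thesis
    using epic_normal[OF assms(1,2)] unfolding epi_with_ker_in_def is_kernel_def by metis
qed

lemma triv_fib_iff:
  assumes "X \<in> lobj C" "Y \<in> lobj C" "f \<in> arr C X Y"
  shows "f \<in> triv_fib M X Y \<longleftrightarrow> epi_with_ker_in C (trivial_objects C M) X Y f"
proof -
  have "lobj C \<inter> trivial_objects C M = trivial_objects C M" using trivial_obj by blast
  then show ?thesis
    using abelian_model assms unfolding abelian_model_structure_def all_fibrant by metis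
qed

text \<open>If \<open>X\<close> is trivially cofibrant, the arrow from zero to \<open>X\<close> is a
  trivial cofibration and lifts against every epimorphism, these being the fibrations. If
  \<open>X\<close> is projective, that arrow is factored into a trivial cofibration \<open>i\<close>
  and an epimorphism \<open>p\<close> onto \<open>X\<close>; a section of \<open>p\<close> exhibits
  the arrow as a retract of \<open>i\<close>.\<close>

lemma projectives_eq: "projectives C = cofibrant_objects C M \<inter> trivial_objects C M"
proof (intro equalityI subsetI)
  obtain O' where O': "is_zero C O'" using ex_zero by blast
  then have Oobj: "O' \<in> lobj C" unfolding is_zero_def by blast
  {
    fix X assume X: "X \<in> cofibrant_objects C M \<inter> trivial_objects C M"
    then have Xo: "X \<in> lobj C" using trivial_obj by blast
    have z: "zero_arr C O' X \<in> arr C O' X" using zero_arr_arr Oobj Xo by blast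
    then have tc: "zero_arr C O' X \<in> triv_cof M O' X"
      unfolding triv_cof_iff[OF Oobj Xo z] mono_with_coker_in_def
      using X monic_from_zero[OF O' z] cokernel_from_zero[OF O' Xo z] by blast
    have "\<exists>g\<in>arr C X Y. lcomp C X Y Z e g = f"
      if "Y \<in> lobj C" "Z \<in> lobj C" "epic C Y Z e" "f \<in> arr C X Z" for Y Z e f
    proof -
      have e: "e \<in> arr C Y Z" using that unfolding epic_def by blast
      \<comment> \<open>The square has the zero object in its upper left corner, so it commutes for
        every \<open>f\<close>; its diagonal lifts \<open>f\<close> along \<open>e\<close>.\<close>
      have "lcomp C O' Y Z e (zero_arr C O' Y) = lcomp C O' X Z f (zero_arr C O' X)"
        using that comp_zero Oobj Xo e by simp
      moreover have "has_lifting C (triv_cof M) (fib M)"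
        using model unfolding model_structure_def by blast
      moreover have "e \<in> fib M Y Z" using fib_iff that e by blast
      ultimately show ?thesis
        using tc that Oobj Xo zero_arr_arr[of O' Y] unfolding has_lifting_def by blast
    qed
    with Xo show "X \<in> projectives C" unfolding projectives_def by blast
  }
  {
    fix X assume X: "X \<in> projectives C"
    then have Xo: "X \<in> lobj C" unfolding projectives_def by blast
    have z: "zero_arr C O' X \<in> arr C O' X" using zero_arr_arr Oobj Xo by blast
    have "has_factorizations C (triv_cof M) (fib M)"
      using model unfolding model_structure_def by blast
    then obtain Z i p where Z: "Z \<in> lobj C" and i: "i \<in> triv_cof M O' Z"
      and p: "p \<in> fib M Z X" and f: "zero_arr C O' X = lcomp C O' Z X p i"
      using z Oobj Xo unfolding has_factorizations_def by blast
    have ia: "i \<in> arr C O' Z" using i cof_arr Oobj Z unfolding triv_cof_def by blast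
    have pa: "p \<in> arr C Z X" using p fib_arr Z Xo by blast
    obtain s where s: "s \<in> arr C X Z" "lcomp C X Z X p s = lid C X"
      using X fib_iff[OF Z Xo pa] p Z Xo id_arr[OF Xo] unfolding projectives_def by blast
    \<comment> \<open>These are the equations of a retract with the identity of the zero object on
      the source side and \<open>s\<close>, \<open>p\<close> on the target side. The first square
      commutes because its arrows start at zero.\<close>
    have "lcomp C O' O' Z i (lid C O') = lcomp C O' X Z s (zero_arr C O' X)"
      using zero_unique_from[OF O' Z comp_arr[OF Oobj Oobj Z id_arr[OF Oobj] ia]
          comp_arr[OF Oobj Xo Z z s(1)]] .
    moreover have "lcomp C O' O' X (zero_arr C O' X) (lid C O') = lcomp C O' Z X p i"
      using comp_id f z Oobj Xo by simp
    moreover have "lcomp C O' O' O' (lid C O') (lid C O') = lid C O'"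
      using id_comp[OF Oobj Oobj id_arr[OF Oobj]] .
    ultimately have "retract_of C O' X (zero_arr C O' X) O' Z i"
      unfolding retract_of_def
      by (intro bexI[of _ "lid C O'"] bexI[of _ s] bexI[of _ p] conjI s pa id_arr Oobj)
    moreover have "i \<in> cof M O' Z" "i \<in> weq M O' Z"
      using i unfolding triv_cof_def by blast+
    moreover have "closed_under_retracts C (cof M)" "closed_under_retracts C (weq M)"
      using model unfolding model_structure_def by blast+
    ultimately have cw: "zero_arr C O' X \<in> cof M O' X" "zero_arr C O' X \<in> weq M O' X"
      using z Oobj Xo Z unfolding closed_under_retracts_def by meson+
    have "equivclp (\<lambda>X Y. X \<in> lobj C \<and> Y \<in> lobj C \<and> weq M X Y \<noteq> {}) X O'"
      using cw Oobj Xo by (intro converse_r_into_equivclp) blast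
    then show "X \<in> cofibrant_objects C M \<inter> trivial_objects C M"
      using cw O' Xo unfolding cofibrant_objects_def trivial_objects_def by blast
  }
qed

lemma mono_with_trivial_coker_weq:
  assumes obj: "X \<in> lobj C" "Y \<in> lobj C"
    and i: "mono_with_coker_in C (trivial_objects C M) X Y i"
  shows "i \<in> weq M X Y"
proof -
  have mi: "monic C X Y i" using i unfolding mono_with_coker_in_def by blast
  then have ia: "i \<in> arr C X Y" unfolding monic_def by blast
  obtain E e where E: "E \<in> trivial_objects C M" "is_cokernel C X Y i E e"
    using i unfolding mono_with_coker_in_def by blast
  have "has_factorizations C (cof M) (triv_fib M)"
    using model unfolding model_structure_def by blast
  then obtain W j p where W: "W \<in> lobj C" and j: "j \<in> cof M X W"
    and p: "p \<in> triv_fib M W Y" and f: "i = lcomp C X W Y p j"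
    using ia obj unfolding has_factorizations_def by blast
  have ja: "j \<in> arr C X W" using j cof_arr obj W by blast
  have pa: "p \<in> arr C W Y" using p fib_arr obj W unfolding triv_fib_def by blast
  obtain D c where mj: "monic C X W j" and D: "D \<in> cofibrant_objects C M"
    and cj: "is_cokernel C X W j D c"
    using j cof_iff[OF obj(1) W ja] unfolding mono_with_coker_in_def by blast
  obtain K m where ep: "epic C W Y p" and K: "K \<in> trivial_objects C M"
    and kp: "is_kernel C W Y p K m"
    using p triv_fib_iff[OF W obj(2) pa] unfolding epi_with_ker_in_def by blast
  obtain d where d: "epic C D E d" "is_kernel C D E d K (lcomp C K W D c m)"
    using cokernel_of_factorization[OF obj(1) W obj(2) ja cj mj ep kp f mi E(2)] by blast
  have Do: "D \<in> lobj C" and Eo: "E \<in> lobj C" and da: "d \<in> arr C D E"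
    using d unfolding is_kernel_def by blast+
  have "d \<in> triv_fib M D E"
    using triv_fib_iff[OF Do Eo da] d K unfolding epi_with_ker_in_def by blast
  then have "D \<in> trivial_objects C M"
    using trivial_objects_weq[OF Do E(1)] unfolding triv_fib_def by blast
  then have "j \<in> triv_cof M X W"
    using triv_cof_iff[OF obj(1) W ja] mj D cj unfolding mono_with_coker_in_def by blast
  then show ?thesis
    unfolding f using p weq_comp obj W unfolding triv_cof_def triv_fib_def by blast
qed

text \<open>The conditions are joined in a cycle: a weak equivalence factors with projective
  cokernel, projectives are trivial, and both factors of a factorization with trivial cokernel and
  kernel are weak equivalences.\<close>

proposition weq_iff_factors:
  assumes obj: "X \<in> lobj C" "Y \<in> lobj C"
  shows weq_iff_factors_trivial:
      "f \<in> weq M X Y \<longleftrightarrow> factors_mono_epi C (trivial_objects C M) (trivial_objects C M) X Y f"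
        (is "_ \<longleftrightarrow> ?triv")
    and weq_iff_factors_projective:
      "f \<in> weq M X Y \<longleftrightarrow> factors_mono_epi C (projectives C) (trivial_objects C M) X Y f"
        (is "_ \<longleftrightarrow> ?proj")
proof -
  have "?proj" if f: "f \<in> weq M X Y"
  proof -
    have "has_factorizations C (triv_cof M) (fib M)"
      using model unfolding model_structure_def by blast
    moreover have "f \<in> arr C X Y" using f weq_arr obj by blast
    ultimately obtain Z i p where Z: "Z \<in> lobj C" and i: "i \<in> triv_cof M X Z"
      and p: "p \<in> fib M Z Y" and fip: "f = lcomp C X Z Y p i"
      using obj unfolding has_factorizations_def by blast
    have ia: "i \<in> arr C X Z" using i cof_arr obj Z unfolding triv_cof_def by blast
    have pa: "p \<in> arr C Z Y" using p fib_arr obj Z by blast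
    \<comment> \<open>Two out of three: \<open>f\<close> and \<open>i\<close> are weak equivalences,
      hence so is the fibration \<open>p\<close>, and its kernel is therefore trivial.\<close>
    have "p \<in> triv_fib M Z Y"
      using weq_cancel_right[of X Z Y i p] i p pa f fip obj Z
      unfolding triv_cof_def triv_fib_def by blast
    then show ?thesis
      using i Z ia pa fip triv_cof_iff[OF obj(1) Z ia] triv_fib_iff[OF Z obj(2) pa]
      unfolding factors_mono_epi_def projectives_eq by blast
  qed
  moreover have "?triv" if "?proj"
    using that unfolding factors_mono_epi_def mono_with_coker_in_def projectives_eq by blast
  moreover have "f \<in> weq M X Y" if fact: "?triv"
  proof -
    obtain Z i p where Z: "Z \<in> lobj C" "p \<in> arr C Z Y" "f = lcomp C X Z Y p i"
      "mono_with_coker_in C (trivial_objects C M) X Z i"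
      "epi_with_ker_in C (trivial_objects C M) Z Y p"
      using fact unfolding factors_mono_epi_def by blast
    then have "i \<in> weq M X Z" "p \<in> weq M Z Y"
      using mono_with_trivial_coker_weq triv_fib_iff obj unfolding triv_fib_def by blast+
    then show ?thesis using Z weq_comp obj by blast
  qed
  ultimately show "f \<in> weq M X Y \<longleftrightarrow> ?triv" "f \<in> weq M X Y \<longleftrightarrow> ?proj" by blast+
qed

end


section \<open>Opposite categories and model structures\<close>

text \<open>Hom modules are re-indexed and composition takes its arguments in reverse, while the
  elements that serve as arrows stay the same. Each notion then becomes its dual by rewriting, with
  no translation of arrows.\<close>

definition op_cat :: "('o, 'm, 'k) lincat \<Rightarrow> ('o, 'm, 'k) lincat" where
  "op_cat C = \<lparr>lobj = lobj C, lhom = (\<lambda>X Y. lhom C Y X), lid = lid C,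
     lcomp = (\<lambda>X Y Z g f. lcomp C Z Y X f g)\<rparr>"

definition op_model :: "('o, 'm) model_str \<Rightarrow> ('o, 'm) model_str" where
  "op_model M = \<lparr>cof = (\<lambda>X Y. fib M Y X), fib = (\<lambda>X Y. cof M Y X), weq = (\<lambda>X Y. weq M Y X)\<rparr>"

lemma op_cat_simps [simp]:
  "lobj (op_cat C) = lobj C" "lid (op_cat C) = lid C"
  "lcomp (op_cat C) X Y Z g f = lcomp C Z Y X f g"
  "arr (op_cat C) X Y = arr C Y X" "zero_arr (op_cat C) X Y = zero_arr C Y X"
  by (simp_all add: op_cat_def arr_def zero_arr_def)

lemma op_model_simps [simp]:
  "cof (op_model M) = (\<lambda>X Y. fib M Y X)" "fib (op_model M) = (\<lambda>X Y. cof M Y X)"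
  "weq (op_model M) = (\<lambda>X Y. weq M Y X)"
  "triv_cof (op_model M) = (\<lambda>X Y. triv_fib M Y X)"
  "triv_fib (op_model M) = (\<lambda>X Y. triv_cof M Y X)"
  by (simp_all add: op_model_def triv_cof_def triv_fib_def fun_eq_iff)

lemma op_notions [simp]:
  "monic (op_cat C) X Y f = epic C Y X f" "epic (op_cat C) X Y f = monic C Y X f"
  "is_zero (op_cat C) Z = is_zero C Z"
  "is_kernel (op_cat C) X Y f K j = is_cokernel C Y X f K j"
  "is_cokernel (op_cat C) X Y f K j = is_kernel C Y X f K j"
  by (auto simp: monic_def epic_def is_zero_def is_kernel_def is_cokernel_def)

lemma op_mono_epi [simp]:
  "mono_with_coker_in (op_cat C) S X Y f = epi_with_ker_in C S Y X f"
  "epi_with_ker_in (op_cat C) S X Y f = mono_with_coker_in C S Y X f"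
  by (simp_all add: mono_with_coker_in_def epi_with_ker_in_def)

text \<open>The middle object stays the same; the monic and the epic factor trade places, and with
  them \<open>S\<close> and \<open>T\<close>.\<close>

lemma op_factors [simp]: "factors_mono_epi (op_cat C) S T X Y f = factors_mono_epi C T S Y X f"
  unfolding factors_mono_epi_def by auto

lemma op_projectives [simp]: "projectives (op_cat C) = injectives C"
  unfolding projectives_def injectives_def by auto

lemma op_cofibrant [simp]:
  "cofibrant_objects (op_cat C) (op_model M) = fibrant_objects C M"
  "fibrant_objects (op_cat C) (op_model M) = cofibrant_objects C M"
  by (simp_all add: cofibrant_objects_def fibrant_objects_def)

text \<open>Zigzags may be walked in either direction: \<open>equivclp\<close> symmetrises the
  relation, so reversing all weak equivalences does not change it.\<close>

lemma op_trivial [simp]: "trivial_objects (op_cat C) (op_model M) = trivial_objects C M"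
proof -
  have "equivclp (\<lambda>X Y. X \<in> lobj C \<and> Y \<in> lobj C \<and> weq M Y X \<noteq> {}) =
    equivclp (\<lambda>X Y. X \<in> lobj C \<and> Y \<in> lobj C \<and> weq M X Y \<noteq> {})"
    unfolding equivclp_def symclp_def by (intro arg_cong[where f = rtranclp] ext) blast
  then show ?thesis unfolding trivial_objects_def by simp
qed

text \<open>The axioms are dual in pairs: lifting of trivial cofibrations against fibrations becomes
  lifting of cofibrations against trivial fibrations, and likewise for the factorizations. In
  two-out-of-three the two cancellation clauses change places, and for retracts the four comparison
  arrows are permuted.\<close>

lemma op_model_structure:
  assumes "model_structure C M"
  shows "model_structure (op_cat C) (op_model M)"
proof -
  note M = assms[unfolded model_structure_def]
  have W: "wide_subcategory (op_cat C) (\<lambda>X Y. W Y X)" if "wide_subcategory C W" for W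
    using that unfolding wide_subcategory_def by simp
  have R: "closed_under_retracts (op_cat C) (\<lambda>X Y. W Y X)" if "closed_under_retracts C W" for W
    using that unfolding closed_under_retracts_def retract_of_def op_cat_simps by metis
  have L: "has_lifting (op_cat C) (\<lambda>X Y. S Y X) (\<lambda>X Y. L Y X)" if "has_lifting C L S" for L S
    using that unfolding has_lifting_def op_cat_simps by metis
  have F: "has_factorizations (op_cat C) (\<lambda>X Y. S Y X) (\<lambda>X Y. L Y X)"
    if "has_factorizations C L S" for L S
    using that unfolding has_factorizations_def op_cat_simps by metis
  have T: "two_out_of_three (op_cat C) (\<lambda>X Y. weq M Y X)"
    using M unfolding two_out_of_three_def op_cat_simps by blast
  show ?thesis
    unfolding model_structure_def using M W R L F T by simp
qed

lemma op_abelian_model_structure: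
  "abelian_model_structure C M \<Longrightarrow> abelian_model_structure (op_cat C) (op_model M)"
  unfolding abelian_model_structure_def using op_model_structure[of C M] by simp

text \<open>Each assumption of the locale is dual to another one or to itself, so rewriting turns
  every goal into its partner.\<close>

lemma (in normal_category) op_normal_category: "normal_category (op_cat C)"
proof
  show "\<And>X Y f. X \<in> lobj (op_cat C) \<Longrightarrow> Y \<in> lobj (op_cat C) \<Longrightarrow> monic (op_cat C) X Y f \<Longrightarrow>
      \<exists>Z c. is_cokernel (op_cat C) X Y f Z c \<and> is_kernel (op_cat C) Y Z c X f"
    using epic_normal by simp
  show "\<And>X Y f. X \<in> lobj (op_cat C) \<Longrightarrow> Y \<in> lobj (op_cat C) \<Longrightarrow> epic (op_cat C) X Y f \<Longrightarrow>
      \<exists>Z c. is_kernel (op_cat C) X Y f Z c \<and> is_cokernel (op_cat C) Z X c Y f"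
    using monic_normal by simp
qed (simp_all add: id_arr comp_arr id_comp comp_id comp_assoc zero_arr_arr comp_zero zero_comp
  ex_zero monicI epicI)


section \<open>Kernels and cokernels of module homomorphisms\<close>

lemma left_moduleI:
  assumes "ring R"
    and add: "\<And>x y. \<lbrakk>x \<in> carrier M; y \<in> carrier M\<rbrakk> \<Longrightarrow> x \<oplus>\<^bsub>M\<^esub> y \<in> carrier M"
    and zero: "\<zero>\<^bsub>M\<^esub> \<in> carrier M"
    and assoc: "\<And>x y z. \<lbrakk>x \<in> carrier M; y \<in> carrier M; z \<in> carrier M\<rbrakk> \<Longrightarrow>
      (x \<oplus>\<^bsub>M\<^esub> y) \<oplus>\<^bsub>M\<^esub> z = x \<oplus>\<^bsub>M\<^esub> (y \<oplus>\<^bsub>M\<^esub> z)"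
    and comm: "\<And>x y. \<lbrakk>x \<in> carrier M; y \<in> carrier M\<rbrakk> \<Longrightarrow> x \<oplus>\<^bsub>M\<^esub> y = y \<oplus>\<^bsub>M\<^esub> x"
    and l_zero: "\<And>x. x \<in> carrier M \<Longrightarrow> \<zero>\<^bsub>M\<^esub> \<oplus>\<^bsub>M\<^esub> x = x"
    and l_inv: "\<And>x. x \<in> carrier M \<Longrightarrow> \<exists>y\<in>carrier M. y \<oplus>\<^bsub>M\<^esub> x = \<zero>\<^bsub>M\<^esub>"
    and smult: "\<And>a x. \<lbrakk>a \<in> carrier R; x \<in> carrier M\<rbrakk> \<Longrightarrow> a \<odot>\<^bsub>M\<^esub> x \<in> carrier M"
    and l_distr: "\<And>a b x. \<lbrakk>a \<in> carrier R; b \<in> carrier R; x \<in> carrier M\<rbrakk> \<Longrightarrow>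
      (a \<oplus>\<^bsub>R\<^esub> b) \<odot>\<^bsub>M\<^esub> x = a \<odot>\<^bsub>M\<^esub> x \<oplus>\<^bsub>M\<^esub> b \<odot>\<^bsub>M\<^esub> x"
    and r_distr: "\<And>a x y. \<lbrakk>a \<in> carrier R; x \<in> carrier M; y \<in> carrier M\<rbrakk> \<Longrightarrow>
      a \<odot>\<^bsub>M\<^esub> (x \<oplus>\<^bsub>M\<^esub> y) = a \<odot>\<^bsub>M\<^esub> x \<oplus>\<^bsub>M\<^esub> a \<odot>\<^bsub>M\<^esub> y"
    and assoc1: "\<And>a b x. \<lbrakk>a \<in> carrier R; b \<in> carrier R; x \<in> carrier M\<rbrakk> \<Longrightarrow>
      (a \<otimes>\<^bsub>R\<^esub> b) \<odot>\<^bsub>M\<^esub> x = a \<odot>\<^bsub>M\<^esub> (b \<odot>\<^bsub>M\<^esub> x)"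
    and one: "\<And>x. x \<in> carrier M \<Longrightarrow> \<one>\<^bsub>R\<^esub> \<odot>\<^bsub>M\<^esub> x = x"
  shows "left_module R M"
  by (intro left_module.intro left_module_axioms.intro assms abelian_groupI)

lemma (in left_module) smult_zero:
  assumes "a \<in> carrier R"
  shows "a \<odot>\<^bsub>M\<^esub> \<zero>\<^bsub>M\<^esub> = \<zero>\<^bsub>M\<^esub>"
proof -
  have "a \<odot>\<^bsub>M\<^esub> \<zero>\<^bsub>M\<^esub> \<oplus>\<^bsub>M\<^esub> a \<odot>\<^bsub>M\<^esub> \<zero>\<^bsub>M\<^esub> = a \<odot>\<^bsub>M\<^esub> \<zero>\<^bsub>M\<^esub>"
    using smult_r_distr[OF assms M.zero_closed M.zero_closed] by simp
  then show ?thesis using smult_closed[OF assms M.zero_closed] M.add.l_cancel_one by metis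
qed

lemma is_linearD:
  assumes "is_linear R M N f"
  shows "x \<in> carrier M \<Longrightarrow> f x \<in> carrier N"
    and "\<lbrakk>x \<in> carrier M; y \<in> carrier M\<rbrakk> \<Longrightarrow> f (x \<oplus>\<^bsub>M\<^esub> y) = f x \<oplus>\<^bsub>N\<^esub> f y"
    and "\<lbrakk>a \<in> carrier R; x \<in> carrier M\<rbrakk> \<Longrightarrow> f (a \<odot>\<^bsub>M\<^esub> x) = a \<odot>\<^bsub>N\<^esub> f x"
  using assms unfolding is_linear_def by auto

lemma is_linearI:
  assumes "\<And>x. x \<in> carrier M \<Longrightarrow> f x \<in> carrier N"
    and "\<And>x y. \<lbrakk>x \<in> carrier M; y \<in> carrier M\<rbrakk> \<Longrightarrow> f (x \<oplus>\<^bsub>M\<^esub> y) = f x \<oplus>\<^bsub>N\<^esub> f y"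
    and "\<And>a x. \<lbrakk>a \<in> carrier R; x \<in> carrier M\<rbrakk> \<Longrightarrow> f (a \<odot>\<^bsub>M\<^esub> x) = a \<odot>\<^bsub>N\<^esub> f x"
  shows "is_linear R M N f"
  using assms unfolding is_linear_def by auto

lemma linear_zero:
  assumes "left_module R M" "left_module R N" "is_linear R M N f"
  shows "f \<zero>\<^bsub>M\<^esub> = \<zero>\<^bsub>N\<^esub>"
proof -
  interpret M: left_module R M by fact
  interpret N: left_module R N by fact
  have "f \<zero>\<^bsub>M\<^esub> \<oplus>\<^bsub>N\<^esub> f \<zero>\<^bsub>M\<^esub> = f \<zero>\<^bsub>M\<^esub>"
    using is_linearD(2)[OF assms(3), of "\<zero>\<^bsub>M\<^esub>" "\<zero>\<^bsub>M\<^esub>"] by simp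
  then show ?thesis using is_linearD(1)[OF assms(3)] N.M.add.l_cancel_one M.M.zero_closed by metis
qed

lemma linear_minus:
  assumes "left_module R M" "left_module R N" "is_linear R M N f" "x \<in> carrier M"
  shows "f (\<ominus>\<^bsub>M\<^esub> x) = \<ominus>\<^bsub>N\<^esub> f x"
proof -
  interpret M: left_module R M by fact
  interpret N: left_module R N by fact
  have "f (\<ominus>\<^bsub>M\<^esub> x) \<oplus>\<^bsub>N\<^esub> f x = \<zero>\<^bsub>N\<^esub>"
    using is_linearD(2)[OF assms(3), of "\<ominus>\<^bsub>M\<^esub> x" x] assms(4) linear_zero[OF assms(1-3)]
    by (simp add: M.M.l_neg)
  then show ?thesis using is_linearD(1)[OF assms(3)] assms(4)
    by (simp add: N.M.minus_equality)
qed

text \<open>Equality of values is traded for membership in the kernel, both for injectivity and for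
  the well-definedness of maps out of a cokernel.\<close>

lemma linear_eq_iff:
  assumes "left_module R M" "left_module R N" "is_linear R M N f" "x \<in> carrier M" "y \<in> carrier M"
  shows "f x = f y \<longleftrightarrow> f (x \<oplus>\<^bsub>M\<^esub> \<ominus>\<^bsub>M\<^esub> y) = \<zero>\<^bsub>N\<^esub>"
proof -
  interpret M: left_module R M by fact
  interpret N: left_module R N by fact
  have "f (x \<oplus>\<^bsub>M\<^esub> \<ominus>\<^bsub>M\<^esub> y) = f x \<oplus>\<^bsub>N\<^esub> \<ominus>\<^bsub>N\<^esub> f y"
    using is_linearD(2)[OF assms(3)] linear_minus[OF assms(1-3)] assms(4,5) by simp
  then show ?thesis
    using is_linearD(1)[OF assms(3)] assms(4,5)
    by (metis N.M.add.inv_equality N.M.add.inv_inv N.M.add.inv_closed N.M.r_neg)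
qed

lemma inj_on_if_trivial_kernel:
  assumes "left_module R M" "left_module R N" "is_linear R M N f"
    and "\<And>x. x \<in> carrier M \<Longrightarrow> f x = \<zero>\<^bsub>N\<^esub> \<Longrightarrow> x = \<zero>\<^bsub>M\<^esub>"
  shows "inj_on f (carrier M)"
proof (rule inj_onI)
  fix x y assume xy: "x \<in> carrier M" "y \<in> carrier M" "f x = f y"
  interpret M: left_module R M by fact
  have "x \<oplus>\<^bsub>M\<^esub> \<ominus>\<^bsub>M\<^esub> y = \<zero>\<^bsub>M\<^esub>"
    using assms(4) xy linear_eq_iff[OF assms(1-3) xy(1,2)] by simp
  then show "x = y" using xy by (metis M.M.add.inv_equality M.M.add.inv_inv M.M.add.inv_closed)
qed

text \<open>Only the carrier shrinks: the operations and the element type remain those of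
  \<open>M\<close>, so the kernel stays in the universe.\<close>

definition ker_module ::
    "('r, 'm) module \<Rightarrow> ('r, 'n) module \<Rightarrow> ('m \<Rightarrow> 'n) \<Rightarrow> ('r, 'm) module" where
  "ker_module M N f = M\<lparr>carrier := {x \<in> carrier M. f x = \<zero>\<^bsub>N\<^esub>}\<rparr>"

lemma ker_module_simps [simp]:
  "carrier (ker_module M N f) = {x \<in> carrier M. f x = \<zero>\<^bsub>N\<^esub>}"
  "\<zero>\<^bsub>ker_module M N f\<^esub> = \<zero>\<^bsub>M\<^esub>"
  "x \<oplus>\<^bsub>ker_module M N f\<^esub> y = x \<oplus>\<^bsub>M\<^esub> y"
  "a \<odot>\<^bsub>ker_module M N f\<^esub> x = a \<odot>\<^bsub>M\<^esub> x"
  by (simp_all add: ker_module_def)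

lemma ker_module:
  assumes "left_module R M" "left_module R N" "is_linear R M N f"
  shows "left_module R (ker_module M N f)"
proof -
  interpret M: left_module R M by fact
  interpret N: left_module R N by fact
  note f = is_linearD[OF assms(3)] linear_zero[OF assms] linear_minus[OF assms]
  show ?thesis
  proof (rule left_moduleI)
    fix x assume "x \<in> carrier (ker_module M N f)"
    then show "\<exists>y\<in>carrier (ker_module M N f). y \<oplus>\<^bsub>ker_module M N f\<^esub> x = \<zero>\<^bsub>ker_module M N f\<^esub>"
      by (intro bexI[of _ "\<ominus>\<^bsub>M\<^esub> x"]) (auto simp: f M.M.l_neg)
  qed (auto simp: f M.M.a_ac M.smult_closed N.smult_zero M.smult_l_distr
      M.smult_r_distr M.smult_assoc1 M.smult_one M.R.ring_axioms)
qed

text \<open>Every module axiom for \<open>N\<close> is checked on preimages under \<open>r\<close>.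
  The lemma serves to make the chosen coset representatives a module.\<close>

lemma surjective_image_module:
  assumes "left_module R M" and N: "carrier N = r ` carrier M" "\<zero>\<^bsub>N\<^esub> = r \<zero>\<^bsub>M\<^esub>"
    and add: "\<And>x y. \<lbrakk>x \<in> carrier M; y \<in> carrier M\<rbrakk> \<Longrightarrow> r x \<oplus>\<^bsub>N\<^esub> r y = r (x \<oplus>\<^bsub>M\<^esub> y)"
    and smult: "\<And>a x. \<lbrakk>a \<in> carrier R; x \<in> carrier M\<rbrakk> \<Longrightarrow> a \<odot>\<^bsub>N\<^esub> r x = r (a \<odot>\<^bsub>M\<^esub> x)"
  shows "left_module R N"
proof -
  interpret M: left_module R M by fact
  show ?thesis
  proof (rule left_moduleI)
    fix x assume "x \<in> carrier N"
    then obtain x' where "x' \<in> carrier M" "x = r x'" unfolding N by blast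
    then have "r (\<ominus>\<^bsub>M\<^esub> x') \<in> carrier N" "r (\<ominus>\<^bsub>M\<^esub> x') \<oplus>\<^bsub>N\<^esub> x = \<zero>\<^bsub>N\<^esub>"
      unfolding N by (auto simp: add M.M.l_neg)
    then show "\<exists>y\<in>carrier N. y \<oplus>\<^bsub>N\<^esub> x = \<zero>\<^bsub>N\<^esub>" by blast
  qed (auto simp: N add smult M.M.a_ac M.smult_closed M.smult_l_distr
      M.smult_r_distr M.smult_assoc1 M.smult_one M.R.ring_axioms)
qed

text \<open>Cosets of the image of \<open>f\<close> are represented by chosen elements, so that the cokernel lives
  on the same type as the codomain.\<close>

definition coset_rep :: "('r, 'l) module \<Rightarrow> ('r, 'm) module \<Rightarrow> ('l \<Rightarrow> 'm) \<Rightarrow> 'm \<Rightarrow> 'm" where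
  "coset_rep L M f x = (SOME y. \<exists>l\<in>carrier L. y = f l \<oplus>\<^bsub>M\<^esub> x)"

definition coker_module ::
    "('r, 'l) module \<Rightarrow> ('r, 'm) module \<Rightarrow> ('l \<Rightarrow> 'm) \<Rightarrow> ('r, 'm) module" where
  "coker_module L M f = \<lparr>carrier = coset_rep L M f ` carrier M, monoid.mult = undefined,
     one = undefined, ring.zero = coset_rep L M f \<zero>\<^bsub>M\<^esub>,
     ring.add = (\<lambda>x y. coset_rep L M f (x \<oplus>\<^bsub>M\<^esub> y)), smult = (\<lambda>a x. coset_rep L M f (a \<odot>\<^bsub>M\<^esub> x))\<rparr>"

lemma coker_module_simps [simp]:
  "carrier (coker_module L M f) = coset_rep L M f ` carrier M"
  "\<zero>\<^bsub>coker_module L M f\<^esub> = coset_rep L M f \<zero>\<^bsub>M\<^esub>"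
  "x \<oplus>\<^bsub>coker_module L M f\<^esub> y = coset_rep L M f (x \<oplus>\<^bsub>M\<^esub> y)"
  "a \<odot>\<^bsub>coker_module L M f\<^esub> x = coset_rep L M f (a \<odot>\<^bsub>M\<^esub> x)"
  by (simp_all add: coker_module_def)

context
  fixes R :: "('r, 's) ring_scheme" and L :: "('r, 'l) module" and M :: "('r, 'm) module" and f
  assumes LM: "left_module R L" "left_module R M" "is_linear R L M f"
begin

interpretation L: left_module R L by (rule LM)
interpretation M: left_module R M by (rule LM)

lemma coset_rep_ex:
  assumes "x \<in> carrier M"
  shows "\<exists>l\<in>carrier L. coset_rep L M f x = f l \<oplus>\<^bsub>M\<^esub> x"
proof -
  have "\<exists>y. \<exists>l\<in>carrier L. y = f l \<oplus>\<^bsub>M\<^esub> x" by blast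
  then show ?thesis unfolding coset_rep_def by (rule someI_ex)
qed

text \<open>The predicate under the choice operator describes the coset of its argument. Both sides
  describe the same coset, so the same element is chosen, whichever it is.\<close>

lemma coset_rep_add_image:
  assumes "x \<in> carrier M" "l \<in> carrier L"
  shows "coset_rep L M f (f l \<oplus>\<^bsub>M\<^esub> x) = coset_rep L M f x"
proof -
  note f = is_linearD[OF LM(3)] linear_minus[OF LM]
  have "(\<exists>m\<in>carrier L. y = f m \<oplus>\<^bsub>M\<^esub> (f l \<oplus>\<^bsub>M\<^esub> x)) = (\<exists>m\<in>carrier L. y = f m \<oplus>\<^bsub>M\<^esub> x)" for y
  proof
    assume "\<exists>m\<in>carrier L. y = f m \<oplus>\<^bsub>M\<^esub> (f l \<oplus>\<^bsub>M\<^esub> x)"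
    then obtain m where "m \<in> carrier L" "y = f m \<oplus>\<^bsub>M\<^esub> (f l \<oplus>\<^bsub>M\<^esub> x)" by blast
    then show "\<exists>m\<in>carrier L. y = f m \<oplus>\<^bsub>M\<^esub> x"
      using assms by (intro bexI[of _ "m \<oplus>\<^bsub>L\<^esub> l"]) (auto simp: f M.M.a_assoc)
  next
    assume "\<exists>m\<in>carrier L. y = f m \<oplus>\<^bsub>M\<^esub> x"
    then obtain m where m: "m \<in> carrier L" "y = f m \<oplus>\<^bsub>M\<^esub> x" by blast
    have "\<ominus>\<^bsub>M\<^esub> f l \<oplus>\<^bsub>M\<^esub> (f l \<oplus>\<^bsub>M\<^esub> x) = x"
      using assms f(1) by (metis M.M.a_assoc M.M.a_inv_closed M.M.l_neg M.M.l_zero)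
    then show "\<exists>m\<in>carrier L. y = f m \<oplus>\<^bsub>M\<^esub> (f l \<oplus>\<^bsub>M\<^esub> x)"
      using assms m by (intro bexI[of _ "m \<oplus>\<^bsub>L\<^esub> \<ominus>\<^bsub>L\<^esub> l"]) (auto simp: f M.M.a_assoc)
  qed
  then show ?thesis unfolding coset_rep_def by presburger
qed

text \<open>Writing both representatives as translates by values of \<open>f\<close> solves for
  \<open>x\<close> as the value at \<open>- l + m\<close>; conversely, a value of \<open>f\<close>
  is a translate of zero. This gives exactness of the pointwise cokernel sequence.\<close>

lemma coset_rep_zero_iff:
  assumes x: "x \<in> carrier M"
  shows "coset_rep L M f x = coset_rep L M f \<zero>\<^bsub>M\<^esub> \<longleftrightarrow> x \<in> f ` carrier L"
proof
  note f = is_linearD[OF LM(3)] linear_minus[OF LM]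
  assume eq: "coset_rep L M f x = coset_rep L M f \<zero>\<^bsub>M\<^esub>"
  obtain l where l: "l \<in> carrier L" "coset_rep L M f x = f l \<oplus>\<^bsub>M\<^esub> x" using coset_rep_ex[OF x] by blast
  obtain m where m: "m \<in> carrier L" "coset_rep L M f \<zero>\<^bsub>M\<^esub> = f m \<oplus>\<^bsub>M\<^esub> \<zero>\<^bsub>M\<^esub>"
    using coset_rep_ex[OF M.M.zero_closed] by blast
  have "f l \<oplus>\<^bsub>M\<^esub> x = f m" using eq l m f(1) by simp
  then have "x = f (\<ominus>\<^bsub>L\<^esub> l \<oplus>\<^bsub>L\<^esub> m)"
    using l m x f by (metis L.M.a_inv_closed M.M.a_assoc M.M.a_inv_closed M.M.l_neg M.M.l_zero)
  then show "x \<in> f ` carrier L" using l m by blast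
next
  assume "x \<in> f ` carrier L"
  then obtain l where l: "l \<in> carrier L" "x = f l" by blast
  then show "coset_rep L M f x = coset_rep L M f \<zero>\<^bsub>M\<^esub>"
    using coset_rep_add_image[of "\<zero>\<^bsub>M\<^esub>" l] x by simp
qed

text \<open>Passing to representatives changes the sum by an element of the image of
  \<open>f\<close>, to which \<open>coset_rep\<close> is blind.\<close>

lemma coset_rep_add:
  assumes "x \<in> carrier M" "y \<in> carrier M"
  shows "coset_rep L M f (coset_rep L M f x \<oplus>\<^bsub>M\<^esub> coset_rep L M f y) = coset_rep L M f (x \<oplus>\<^bsub>M\<^esub> y)"
proof -
  note f = is_linearD[OF LM(3)]
  obtain l where l: "l \<in> carrier L" "coset_rep L M f x = f l \<oplus>\<^bsub>M\<^esub> x"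
    using coset_rep_ex[OF assms(1)] by blast
  obtain m where m: "m \<in> carrier L" "coset_rep L M f y = f m \<oplus>\<^bsub>M\<^esub> y"
    using coset_rep_ex[OF assms(2)] by blast
  have "coset_rep L M f x \<oplus>\<^bsub>M\<^esub> coset_rep L M f y = f (l \<oplus>\<^bsub>L\<^esub> m) \<oplus>\<^bsub>M\<^esub> (x \<oplus>\<^bsub>M\<^esub> y)"
    using l m assms by (simp add: f M.M.a_ac)
  then show ?thesis using coset_rep_add_image l m assms by simp
qed

lemma coset_rep_smult:
  assumes "a \<in> carrier R" "x \<in> carrier M"
  shows "coset_rep L M f (a \<odot>\<^bsub>M\<^esub> coset_rep L M f x) = coset_rep L M f (a \<odot>\<^bsub>M\<^esub> x)"
proof -
  note f = is_linearD[OF LM(3)]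
  obtain l where l: "l \<in> carrier L" "coset_rep L M f x = f l \<oplus>\<^bsub>M\<^esub> x"
    using coset_rep_ex[OF assms(2)] by blast
  then have "a \<odot>\<^bsub>M\<^esub> coset_rep L M f x = f (a \<odot>\<^bsub>L\<^esub> l) \<oplus>\<^bsub>M\<^esub> a \<odot>\<^bsub>M\<^esub> x"
    using assms by (simp add: f M.smult_r_distr)
  then show ?thesis using coset_rep_add_image l assms M.smult_closed L.smult_closed by simp
qed

lemma coker_module: "left_module R (coker_module L M f)"
  by (rule surjective_image_module[OF LM(2), where r = "coset_rep L M f"])
    (simp_all add: coset_rep_add coset_rep_smult)

lemma coset_rep_linear: "is_linear R M (coker_module L M f) (coset_rep L M f)"
  by (rule is_linearI) (simp_all add: coset_rep_add coset_rep_smult)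

end


section \<open>The functor category as a normal category\<close>

lemma compose_eq_iff: "compose S f g = compose S f' g' \<longleftrightarrow> (\<forall>x\<in>S. f (g x) = f' (g' x))"
  unfolding compose_def restrict_def fun_eq_iff by auto

locale module_functors =
  fixes k :: "'k ring" and Q :: "('q, 'h, 'k) lincat" and A :: "('k, 'a) module"
  assumes Q: "linear_category k Q" and A: "assoc_algebra k A"
begin

interpretation Q: linear_category k Q by (rule Q)
interpretation A: assoc_algebra k A by (rule A)

abbreviation C :: "(('q, 'h, ('a, 'm) module, 'm \<Rightarrow> 'm) linfun, 'q \<Rightarrow> 'm \<Rightarrow> 'm, 'k) lincat" where
  "C \<equiv> QA_Mod k Q A"

lemma base_scalar: "c \<in> carrier k \<Longrightarrow> c \<odot>\<^bsub>A\<^esub> \<one>\<^bsub>A\<^esub> \<in> carrier A"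
  by simp

section \<open>Objects and arrows of the functor category in terms of elements\<close>

lemma objD:
  assumes "F \<in> lobj C"
  shows "q \<in> lobj Q \<Longrightarrow> left_module A (fobj F q)"
    and "\<lbrakk>p \<in> lobj Q; q \<in> lobj Q; f \<in> arr Q p q\<rbrakk> \<Longrightarrow>
      is_linear A (fobj F p) (fobj F q) (farr F p q f)"
    and "\<lbrakk>p \<in> lobj Q; q \<in> lobj Q; f \<in> arr Q p q; g \<in> arr Q p q; x \<in> carrier (fobj F p)\<rbrakk> \<Longrightarrow>
      farr F p q (f \<oplus>\<^bsub>lhom Q p q\<^esub> g) x = farr F p q f x \<oplus>\<^bsub>fobj F q\<^esub> farr F p q g x"
    and "\<lbrakk>p \<in> lobj Q; q \<in> lobj Q; c \<in> carrier k; f \<in> arr Q p q; x \<in> carrier (fobj F p)\<rbrakk> \<Longrightarrow>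
      farr F p q (c \<odot>\<^bsub>lhom Q p q\<^esub> f) x = base_smult A (fobj F q) c (farr F p q f x)"
    and "\<lbrakk>q \<in> lobj Q; x \<in> carrier (fobj F q)\<rbrakk> \<Longrightarrow> farr F q q (lid Q q) x = x"
    and "\<lbrakk>p \<in> lobj Q; q \<in> lobj Q; r \<in> lobj Q; f \<in> arr Q p q; g \<in> arr Q q r;
        x \<in> carrier (fobj F p)\<rbrakk> \<Longrightarrow>
      farr F p r (lcomp Q p q r g f) x = farr F q r g (farr F p q f x)"
proof -
  have F: "\<And>q. q \<in> lobj Q \<Longrightarrow> left_module A (fobj F q)"
    "\<And>p q. p \<in> lobj Q \<Longrightarrow> q \<in> lobj Q \<Longrightarrow>
      is_linear k (lhom Q p q) (lhom (Mod_cat k A) (fobj F p) (fobj F q)) (farr F p q)"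
    "\<And>q. q \<in> lobj Q \<Longrightarrow> farr F q q (lid Q q) = (\<lambda>m\<in>carrier (fobj F q). m)"
    "\<And>p q r f g. \<lbrakk>p \<in> lobj Q; q \<in> lobj Q; r \<in> lobj Q; f \<in> arr Q p q; g \<in> arr Q q r\<rbrakk> \<Longrightarrow>
      farr F p r (lcomp Q p q r g f) = compose (carrier (fobj F p)) (farr F q r g) (farr F p q f)"
    using assms unfolding Fun_cat_def linear_functor_def Mod_cat_def by simp_all
  note lin = is_linearD[OF F(2)]
  show "q \<in> lobj Q \<Longrightarrow> left_module A (fobj F q)" by (rule F)
  { assume pq: "p \<in> lobj Q" "q \<in> lobj Q" "f \<in> arr Q p q"
    show "is_linear A (fobj F p) (fobj F q) (farr F p q f)"
      using lin(1)[OF pq(1,2)] pq(3) by (simp add: arr_def Mod_cat_def)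
    { assume "g \<in> arr Q p q" "x \<in> carrier (fobj F p)"
      then show "farr F p q (f \<oplus>\<^bsub>lhom Q p q\<^esub> g) x = farr F p q f x \<oplus>\<^bsub>fobj F q\<^esub> farr F p q g x"
        using lin(2)[OF pq(1,2)] pq(3) by (simp add: arr_def Mod_cat_def) }
    { assume "c \<in> carrier k" "x \<in> carrier (fobj F p)"
      then show "farr F p q (c \<odot>\<^bsub>lhom Q p q\<^esub> f) x = base_smult A (fobj F q) c (farr F p q f x)"
        using lin(3)[OF pq(1,2)] pq(3) by (simp add: arr_def Mod_cat_def) }
    { assume "r \<in> lobj Q" "g \<in> arr Q q r" "x \<in> carrier (fobj F p)"
      then show "farr F p r (lcomp Q p q r g f) x = farr F q r g (farr F p q f x)"
        using F(4) pq by (simp add: compose_def) } }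
  show "\<lbrakk>q \<in> lobj Q; x \<in> carrier (fobj F q)\<rbrakk> \<Longrightarrow> farr F q q (lid Q q) x = x"
    using F(3) by simp
qed

text \<open>The assumptions grant that sums, multiples and composites of arrows of \<open>Q\<close>
  are again arrows. These facts are derived here once from the structure of \<open>Q\<close>, so
  that every later construction of a functor may simply use them.\<close>

lemma objI:
  assumes m: "\<And>q. q \<in> lobj Q \<Longrightarrow> left_module A (fobj F q)"
    and lin: "\<And>p q f. \<lbrakk>p \<in> lobj Q; q \<in> lobj Q; f \<in> arr Q p q\<rbrakk> \<Longrightarrow>
      is_linear A (fobj F p) (fobj F q) (farr F p q f)"
    and ext: "\<And>p q f. \<lbrakk>p \<in> lobj Q; q \<in> lobj Q; f \<in> arr Q p q\<rbrakk> \<Longrightarrow>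
      farr F p q f \<in> extensional (carrier (fobj F p))"
    and add: "\<And>p q f g x. \<lbrakk>p \<in> lobj Q; q \<in> lobj Q; f \<in> arr Q p q; g \<in> arr Q p q;
        f \<oplus>\<^bsub>lhom Q p q\<^esub> g \<in> arr Q p q; x \<in> carrier (fobj F p)\<rbrakk> \<Longrightarrow>
      farr F p q (f \<oplus>\<^bsub>lhom Q p q\<^esub> g) x = farr F p q f x \<oplus>\<^bsub>fobj F q\<^esub> farr F p q g x"
    and smult: "\<And>p q c f x. \<lbrakk>p \<in> lobj Q; q \<in> lobj Q; c \<in> carrier k; f \<in> arr Q p q;
        c \<odot>\<^bsub>lhom Q p q\<^esub> f \<in> arr Q p q; x \<in> carrier (fobj F p)\<rbrakk> \<Longrightarrow>
      farr F p q (c \<odot>\<^bsub>lhom Q p q\<^esub> f) x = base_smult A (fobj F q) c (farr F p q f x)"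
    and id: "\<And>q x. \<lbrakk>q \<in> lobj Q; x \<in> carrier (fobj F q)\<rbrakk> \<Longrightarrow> farr F q q (lid Q q) x = x"
    and comp: "\<And>p q r f g x. \<lbrakk>p \<in> lobj Q; q \<in> lobj Q; r \<in> lobj Q; f \<in> arr Q p q; g \<in> arr Q q r;
        lcomp Q p q r g f \<in> arr Q p r; x \<in> carrier (fobj F p)\<rbrakk> \<Longrightarrow>
      farr F p r (lcomp Q p q r g f) x = farr F q r g (farr F p q f x)"
  shows "F \<in> lobj C"
proof -
  have "is_linear k (lhom Q p q) (lhom (Mod_cat k A) (fobj F p) (fobj F q)) (farr F p q)"
    if pq: "p \<in> lobj Q" "q \<in> lobj Q" for p q
  proof -
    interpret H: module k "lhom Q p q" using Q.hom_module pq by blast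
    show ?thesis
    proof (rule is_linearI)
      fix f assume "f \<in> carrier (lhom Q p q)"
      then have f: "f \<in> arr Q p q" by (simp add: arr_def)
      then show "farr F p q f \<in> carrier (lhom (Mod_cat k A) (fobj F p) (fobj F q))"
        using lin[OF pq] ext[OF pq] is_linearD(1)[OF lin[OF pq]]
        by (simp add: Mod_cat_def PiE_iff)
      { fix g assume "g \<in> carrier (lhom Q p q)"
        then have g: "g \<in> arr Q p q" "f \<oplus>\<^bsub>lhom Q p q\<^esub> g \<in> arr Q p q"
          using f by (simp_all add: arr_def)
        show "farr F p q (f \<oplus>\<^bsub>lhom Q p q\<^esub> g) =
            farr F p q f \<oplus>\<^bsub>lhom (Mod_cat k A) (fobj F p) (fobj F q)\<^esub> farr F p q g"
          by (rule extensionalityI[OF ext[OF pq g(2)]])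
            (simp_all add: Mod_cat_def add pq f g) }
      { fix c assume c: "c \<in> carrier k"
        then have cf: "c \<odot>\<^bsub>lhom Q p q\<^esub> f \<in> arr Q p q"
          using f by (simp add: arr_def)
        show "farr F p q (c \<odot>\<^bsub>lhom Q p q\<^esub> f) =
            c \<odot>\<^bsub>lhom (Mod_cat k A) (fobj F p) (fobj F q)\<^esub> farr F p q f"
          by (rule extensionalityI[OF ext[OF pq cf]])
            (simp_all add: Mod_cat_def smult pq f c cf) }
    qed
  qed
  moreover have "farr F q q (lid Q q) = (\<lambda>m\<in>carrier (fobj F q). m)" if q: "q \<in> lobj Q" for q
    by (rule extensionalityI[OF ext[OF q q Q.id_arr[OF q]]]) (simp_all add: id q)
  moreover have "farr F p r (lcomp Q p q r g f) =
      compose (carrier (fobj F p)) (farr F q r g) (farr F p q f)"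
    if pqr: "p \<in> lobj Q" "q \<in> lobj Q" "r \<in> lobj Q" "f \<in> arr Q p q" "g \<in> arr Q q r" for p q r f g
    by (rule extensionalityI[OF ext[OF pqr(1,3) Q.comp_arr[OF pqr]]])
      (simp_all add: compose_def comp pqr Q.comp_arr[OF pqr])
  ultimately show ?thesis
    using m unfolding Fun_cat_def linear_functor_def by (simp add: Mod_cat_def)
qed

lemma objD_closed:
  "\<lbrakk>F \<in> lobj C; p \<in> lobj Q; q \<in> lobj Q; f \<in> arr Q p q; x \<in> carrier (fobj F p)\<rbrakk> \<Longrightarrow>
   farr F p q f x \<in> carrier (fobj F q)"
  using objD(2) is_linearD(1) by metis

text \<open>Extensionality occurs twice, in the object and in the element; together they make
  equality of arrows a pointwise matter, as \<open>arr_eqI\<close> records.\<close>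

lemma arr_iff:
  "\<eta> \<in> arr C F G \<longleftrightarrow> \<eta> \<in> extensional (lobj Q) \<and>
    (\<forall>q\<in>lobj Q. \<eta> q \<in> extensional (carrier (fobj F q)) \<and>
      is_linear A (fobj F q) (fobj G q) (\<eta> q)) \<and>
    (\<forall>p\<in>lobj Q. \<forall>q\<in>lobj Q. \<forall>f\<in>arr Q p q. \<forall>x\<in>carrier (fobj F p).
      \<eta> q (farr F p q f x) = farr G p q f (\<eta> p x))"
  unfolding arr_def Fun_cat_def Mod_cat_def
  by (auto simp: is_linear_def PiE_iff compose_eq_iff)

lemma arrD:
  assumes "\<eta> \<in> arr C F G"
  shows "q \<in> lobj Q \<Longrightarrow> is_linear A (fobj F q) (fobj G q) (\<eta> q)"
    and "\<lbrakk>p \<in> lobj Q; q \<in> lobj Q; f \<in> arr Q p q; x \<in> carrier (fobj F p)\<rbrakk> \<Longrightarrow>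
      \<eta> q (farr F p q f x) = farr G p q f (\<eta> p x)"
    and "\<lbrakk>q \<in> lobj Q; x \<in> carrier (fobj F q)\<rbrakk> \<Longrightarrow> \<eta> q x \<in> carrier (fobj G q)"
  using assms unfolding arr_iff by (blast intro: is_linearD(1))+

lemma arr_eqI:
  assumes "\<eta> \<in> arr C F G" "\<theta> \<in> arr C F G"
    and "\<And>q x. \<lbrakk>q \<in> lobj Q; x \<in> carrier (fobj F q)\<rbrakk> \<Longrightarrow> \<eta> q x = \<theta> q x"
  shows "\<eta> = \<theta>"
proof (rule extensionalityI[of _ "lobj Q"])
  fix q assume "q \<in> lobj Q"
  then show "\<eta> q = \<theta> q"
    using assms unfolding arr_iff by (intro extensionalityI[of _ "carrier (fobj F q)"]) auto
qed (use assms in \<open>simp_all add: arr_iff\<close>)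

text \<open>Restriction makes any family extensional; linearity and naturality survive it because
  they speak only of elements of the carriers.\<close>

lemma arrI:
  assumes "\<And>q. q \<in> lobj Q \<Longrightarrow> is_linear A (fobj F q) (fobj G q) (\<eta> q)"
    and "\<And>p q f x. \<lbrakk>p \<in> lobj Q; q \<in> lobj Q; f \<in> arr Q p q; x \<in> carrier (fobj F p);
        farr F p q f x \<in> carrier (fobj F q)\<rbrakk> \<Longrightarrow> \<eta> q (farr F p q f x) = farr G p q f (\<eta> p x)"
    and "F \<in> lobj C"
  shows "(\<lambda>q\<in>lobj Q. \<lambda>x\<in>carrier (fobj F q). \<eta> q x) \<in> arr C F G"
proof -
  have "is_linear A (fobj F q) (fobj G q) (\<lambda>x\<in>carrier (fobj F q). \<eta> q x)" if q: "q \<in> lobj Q" for q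
  proof -
    interpret left_module A "fobj F q" by (rule objD(1)[OF assms(3) q])
    note l = is_linearD[OF assms(1)[OF q]]
    show ?thesis by (rule is_linearI) (simp_all add: l smult_closed)
  qed
  then show ?thesis
    unfolding arr_iff using assms(2) objD_closed[OF assms(3)] by simp
qed

lemma comp_apply:
  "\<lbrakk>q \<in> lobj Q; x \<in> carrier (fobj F q)\<rbrakk> \<Longrightarrow> lcomp C F G H \<theta> \<eta> q x = \<theta> q (\<eta> q x)"
  by (simp add: Fun_cat_def Mod_cat_def compose_def)

lemma id_apply: "\<lbrakk>q \<in> lobj Q; x \<in> carrier (fobj F q)\<rbrakk> \<Longrightarrow> lid C F q x = x"
  by (simp add: Fun_cat_def Mod_cat_def)

lemma zero_apply: "\<lbrakk>q \<in> lobj Q; x \<in> carrier (fobj F q)\<rbrakk> \<Longrightarrow> zero_arr C F G q x = \<zero>\<^bsub>fobj G q\<^esub>"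
  by (simp add: Fun_cat_def Mod_cat_def zero_arr_def)

lemma id_in_arr: "F \<in> lobj C \<Longrightarrow> lid C F \<in> arr C F F"
proof -
  assume F: "F \<in> lobj C"
  have "(\<lambda>q\<in>lobj Q. \<lambda>x\<in>carrier (fobj F q). x) \<in> arr C F F"
    by (rule arrI) (auto simp: is_linear_def F objD[OF F])
  then show ?thesis by (simp add: Fun_cat_def Mod_cat_def)
qed

lemma comp_in_arr:
  assumes "F \<in> lobj C" and \<eta>: "\<eta> \<in> arr C F G" and \<theta>: "\<theta> \<in> arr C G H"
  shows "lcomp C F G H \<theta> \<eta> \<in> arr C F H"
proof -
  have "(\<lambda>q\<in>lobj Q. \<lambda>x\<in>carrier (fobj F q). \<theta> q (\<eta> q x)) \<in> arr C F H"
  proof (rule arrI)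
    fix q assume q: "q \<in> lobj Q"
    note l = is_linearD[OF arrD(1)[OF \<eta> q]] is_linearD[OF arrD(1)[OF \<theta> q]]
    show "is_linear A (fobj F q) (fobj H q) (\<lambda>x. \<theta> q (\<eta> q x))"
      by (rule is_linearI) (simp_all add: l)
  qed (use assms arrD[OF \<eta>] arrD[OF \<theta>] objD in auto)
  then show ?thesis by (simp add: Fun_cat_def Mod_cat_def compose_def)
qed

lemma zero_in_arr:
  assumes F: "F \<in> lobj C" and G: "G \<in> lobj C"
  shows "zero_arr C F G \<in> arr C F G"
proof -
  have "(\<lambda>q\<in>lobj Q. \<lambda>x\<in>carrier (fobj F q). \<zero>\<^bsub>fobj G q\<^esub>) \<in> arr C F G"
  proof (rule arrI)
    fix q assume q: "q \<in> lobj Q"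
    interpret left_module A "fobj G q" by (rule objD(1)[OF G q])
    show "is_linear A (fobj F q) (fobj G q) (\<lambda>x. \<zero>\<^bsub>fobj G q\<^esub>)"
      by (rule is_linearI) (simp_all add: smult_zero)
  next
    fix p q f assume "p \<in> lobj Q" "q \<in> lobj Q" "f \<in> arr Q p q"
    then show "\<zero>\<^bsub>fobj G q\<^esub> = farr G p q f \<zero>\<^bsub>fobj G p\<^esub>"
      using linear_zero objD(1,2)[OF G] by metis
  qed (use F objD in auto)
  then show ?thesis by (simp add: Fun_cat_def Mod_cat_def zero_arr_def)
qed

lemma arr_zero: "\<lbrakk>F \<in> lobj C; G \<in> lobj C; \<eta> \<in> arr C F G; q \<in> lobj Q\<rbrakk> \<Longrightarrow>
  \<eta> q \<zero>\<^bsub>fobj F q\<^esub> = \<zero>\<^bsub>fobj G q\<^esub>"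
  using linear_zero objD(1) arrD(1) by metis

lemma comp_zero_iff:
  assumes "F \<in> lobj C" "H \<in> lobj C" "\<eta> \<in> arr C F G" "\<theta> \<in> arr C G H"
  shows "lcomp C F G H \<theta> \<eta> = zero_arr C F H \<longleftrightarrow>
    (\<forall>q\<in>lobj Q. \<forall>x\<in>carrier (fobj F q). \<theta> q (\<eta> q x) = \<zero>\<^bsub>fobj H q\<^esub>)" (is "?L \<longleftrightarrow> ?R")
proof
  assume ?L
  then show ?R using comp_apply zero_apply by metis
next
  assume ?R
  then show ?L
    by (intro arr_eqI[OF comp_in_arr[OF assms(1,3,4)] zero_in_arr[OF assms(1,2)]])
      (simp add: comp_apply zero_apply)
qed

text \<open>An arbitrary type is only known to be inhabited, so \<open>undefined\<close> is the
  element at hand for a one-point carrier inside the universe.\<close>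

definition zero_functor :: "('q, 'h, ('a, 'm) module, 'm \<Rightarrow> 'm) linfun" where
  "zero_functor = \<lparr>fobj = (\<lambda>_. \<lparr>carrier = {undefined}, monoid.mult = undefined, one = undefined,
      ring.zero = undefined, ring.add = (\<lambda>_ _. undefined), smult = (\<lambda>_ _. undefined)\<rparr>),
    farr = (\<lambda>_ _ _. \<lambda>x\<in>{undefined}. undefined)\<rparr>"

lemma zero_functor_eq_zero: "x \<in> carrier (fobj zero_functor q) \<Longrightarrow> x = \<zero>\<^bsub>fobj zero_functor q\<^esub>"
  by (simp add: zero_functor_def)

lemma zero_functor_is_zero:
  "is_zero C (zero_functor :: ('q, 'h, ('a, 'm) module, 'm \<Rightarrow> 'm) linfun)"
proof -
  have "ring A" by unfold_locales
  then have "left_module A (fobj zero_functor q)" for q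
    by (intro left_moduleI) (auto simp: zero_functor_def)
  then have Z: "zero_functor \<in> lobj C"
    by (rule objI) (auto simp: zero_functor_def is_linear_def base_smult_def)
  show ?thesis
    unfolding is_zero_def
  proof (intro conjI ballI Z ex_ex1I)
    fix F :: "('q, 'h, ('a, 'm) module, 'm \<Rightarrow> 'm) linfun" assume F: "F \<in> lobj C"
    show "\<exists>\<eta>. \<eta> \<in> arr C zero_functor F" using zero_in_arr[OF Z F] by blast
    show "\<exists>\<eta>. \<eta> \<in> arr C F zero_functor" using zero_in_arr[OF F Z] by blast
    show "\<eta> = \<theta>"
      if e: "\<eta> \<in> arr C zero_functor F" "\<theta> \<in> arr C zero_functor F" for \<eta> \<theta>
    proof (rule arr_eqI[OF e])
      fix q and x :: 'm assume q: "q \<in> lobj Q" and "x \<in> carrier (fobj zero_functor q)"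
      then have "x = \<zero>\<^bsub>fobj zero_functor q\<^esub>" by (rule_tac zero_functor_eq_zero)
      then show "\<eta> q x = \<theta> q x" using arr_zero[OF Z F e(1) q] arr_zero[OF Z F e(2) q] by simp
    qed
    show "\<eta> = \<theta>"
      if e: "\<eta> \<in> arr C F zero_functor" "\<theta> \<in> arr C F zero_functor" for \<eta> \<theta>
    proof (rule arr_eqI[OF e])
      fix q x assume qx: "q \<in> lobj Q" "x \<in> carrier (fobj F q)"
      show "\<eta> q x = \<theta> q x"
        using arrD(3)[OF e(1) qx] arrD(3)[OF e(2) qx] by (simp add: zero_functor_def)
    qed
  qed
qed

section \<open>Pointwise kernels and cokernels\<close>

definition ker_functor where
  "ker_functor F G \<eta> = \<lparr>fobj = (\<lambda>q. ker_module (fobj F q) (fobj G q) (\<eta> q)),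
     farr = (\<lambda>p q f. restrict (farr F p q f) {x \<in> carrier (fobj F p). \<eta> p x = \<zero>\<^bsub>fobj G p\<^esub>})\<rparr>"

text \<open>By naturality the action of \<open>F\<close> maps the kernel of one component of
  \<open>\<eta>\<close> into that of another; the remaining laws are those of \<open>F\<close>,
  restricted.\<close>

lemma ker_functor:
  assumes F: "F \<in> lobj C" and G: "G \<in> lobj C" and \<eta>: "\<eta> \<in> arr C F G"
  shows "ker_functor F G \<eta> \<in> lobj C"
    and "(\<lambda>q\<in>lobj Q. \<lambda>x\<in>carrier (fobj (ker_functor F G \<eta>) q). x) \<in> arr C (ker_functor F G \<eta>) F"
proof -
  let ?K = "ker_functor F G \<eta>"
  have m: "left_module A (fobj ?K q)" if "q \<in> lobj Q" for q
    using that by (simp add: ker_functor_def ker_module objD(1)[OF F] objD(1)[OF G] arrD(1)[OF \<eta>])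
  have cl: "\<eta> q (farr F p q f x) = \<zero>\<^bsub>fobj G q\<^esub>"
    if "p \<in> lobj Q" "q \<in> lobj Q" "f \<in> arr Q p q" "x \<in> carrier (fobj F p)" "\<eta> p x = \<zero>\<^bsub>fobj G p\<^esub>"
    for p q f x
    using that arrD(2)[OF \<eta> that(1-4)]
      linear_zero[OF objD(1)[OF G that(1)] objD(1)[OF G that(2)] objD(2)[OF G that(1-3)]] by simp
  have car: "x \<in> carrier (fobj ?K q) \<longleftrightarrow> x \<in> carrier (fobj F q) \<and> \<eta> q x = \<zero>\<^bsub>fobj G q\<^esub>" for x q
    by (simp add: ker_functor_def)
  have ops: "x \<oplus>\<^bsub>fobj ?K q\<^esub> y = x \<oplus>\<^bsub>fobj F q\<^esub> y" "a \<odot>\<^bsub>fobj ?K q\<^esub> x = a \<odot>\<^bsub>fobj F q\<^esub> x" for x y a q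
    by (simp_all add: ker_functor_def)
  have farr: "farr ?K p q f x = farr F p q f x" if "x \<in> carrier (fobj ?K p)" for p q f x
    using that by (simp add: ker_functor_def)
  have l: "is_linear A (fobj ?K p) (fobj ?K q) (farr ?K p q f)"
    if pq: "p \<in> lobj Q" "q \<in> lobj Q" "f \<in> arr Q p q" for p q f
  proof (rule is_linearI)
    interpret K: left_module A "fobj ?K p" by (rule m[OF pq(1)])
    note f = is_linearD[OF objD(2)[OF F pq]]
    fix x assume x: "x \<in> carrier (fobj ?K p)"
    then show "farr ?K p q f x \<in> carrier (fobj ?K q)" by (simp add: farr car f cl pq)
    { fix y assume y: "y \<in> carrier (fobj ?K p)"
      then have "x \<oplus>\<^bsub>fobj ?K p\<^esub> y \<in> carrier (fobj ?K p)" using x by simp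
      then show "farr ?K p q f (x \<oplus>\<^bsub>fobj ?K p\<^esub> y) = farr ?K p q f x \<oplus>\<^bsub>fobj ?K q\<^esub> farr ?K p q f y"
        using x y by (simp add: farr ops) (simp add: car f) }
    { fix a assume a: "a \<in> carrier A"
      then have "a \<odot>\<^bsub>fobj ?K p\<^esub> x \<in> carrier (fobj ?K p)" using x K.smult_closed by simp
      then show "farr ?K p q f (a \<odot>\<^bsub>fobj ?K p\<^esub> x) = a \<odot>\<^bsub>fobj ?K q\<^esub> farr ?K p q f x"
        using x a by (simp add: farr ops) (simp add: car f) }
  qed
  show K: "?K \<in> lobj C"
  proof (rule objI[OF m l])
    fix p q f assume pq: "p \<in> lobj Q" "q \<in> lobj Q" "f \<in> arr Q p q"
    show "farr ?K p q f \<in> extensional (carrier (fobj ?K p))" by (simp add: ker_functor_def)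
  qed (auto simp: ker_functor_def objD[OF F] cl objD_closed[OF F] base_smult_def m)
  show "(\<lambda>q\<in>lobj Q. \<lambda>x\<in>carrier (fobj ?K q). x) \<in> arr C ?K F"
    by (rule arrI) (simp_all add: K m car ops farr is_linear_def)
qed

definition coker_functor where
  "coker_functor F G \<eta> = \<lparr>fobj = (\<lambda>q. coker_module (fobj F q) (fobj G q) (\<eta> q)),
     farr = (\<lambda>p q f. \<lambda>x\<in>coset_rep (fobj F p) (fobj G p) (\<eta> p) ` carrier (fobj G p).
       coset_rep (fobj F q) (fobj G q) (\<eta> q) (farr G p q f x))\<rparr>"

lemma coker_functor:
  assumes F: "F \<in> lobj C" and G: "G \<in> lobj C" and \<eta>: "\<eta> \<in> arr C F G"
  shows "coker_functor F G \<eta> \<in> lobj C"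
    and "(\<lambda>q\<in>lobj Q. \<lambda>x\<in>carrier (fobj G q). coset_rep (fobj F q) (fobj G q) (\<eta> q) x)
      \<in> arr C G (coker_functor F G \<eta>)"
proof -
  let ?K = "coker_functor F G \<eta>"
  let ?r = "\<lambda>q. coset_rep (fobj F q) (fobj G q) (\<eta> q)"
  note lm = objD(1)[OF F] objD(1)[OF G] arrD(1)[OF \<eta>]
  have m: "left_module A (fobj ?K q)" if "q \<in> lobj Q" for q
    using that by (simp add: coker_functor_def coker_module lm)
  have k: "fobj ?K q = coker_module (fobj F q) (fobj G q) (\<eta> q)" for q
    by (simp add: coker_functor_def)
  have r: "is_linear A (fobj G q) (fobj ?K q) (?r q)" if "q \<in> lobj Q" for q
    using that by (simp add: coker_functor_def coset_rep_linear lm)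
  \<comment> \<open>These equations are applied from right to left below: a sum or multiple of
    representatives becomes a representative, to which \<open>farr\<close> applies.\<close>
  note add = is_linearD(2)[OF r] and smult = is_linearD(3)[OF r]
  \<comment> \<open>The representative of \<open>x\<close> differs from \<open>x\<close> by
    \<open>\<eta> p l\<close>. Naturality carries this difference into the image of
    \<open>\<eta> q\<close>, which does not affect the representative, so the action is independent
    of the choices.\<close>
  have nat: "?r q (farr G p q f (?r p x)) = ?r q (farr G p q f x)"
    if pq: "p \<in> lobj Q" "q \<in> lobj Q" "f \<in> arr Q p q" and x: "x \<in> carrier (fobj G p)" for p q f x
  proof -
    obtain l where l: "l \<in> carrier (fobj F p)" "?r p x = \<eta> p l \<oplus>\<^bsub>fobj G p\<^esub> x"
      using coset_rep_ex[OF lm x] pq by blast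
    have "farr G p q f (?r p x) = \<eta> q (farr F p q f l) \<oplus>\<^bsub>fobj G q\<^esub> farr G p q f x"
      unfolding l(2) using is_linearD(2)[OF objD(2)[OF G pq]] l x pq arrD[OF \<eta>] by simp
    then show ?thesis
      using coset_rep_add_image[OF lm] pq l x objD_closed[OF F] objD_closed[OF G] by simp
  qed
  have farr: "farr ?K p q f (?r p x) = ?r q (farr G p q f x)"
    if "p \<in> lobj Q" "q \<in> lobj Q" "f \<in> arr Q p q" "x \<in> carrier (fobj G p)" for p q f x
    using that nat by (simp add: coker_functor_def)
  have el: "\<exists>y\<in>carrier (fobj G q). x = ?r q y" if "x \<in> carrier (fobj ?K q)" for x q
    using that by (auto simp: coker_functor_def)
  have rcl: "?r q x \<in> carrier (fobj ?K q)" if "x \<in> carrier (fobj G q)" for x q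
    using that by (auto simp: coker_functor_def)
  have l: "is_linear A (fobj ?K p) (fobj ?K q) (farr ?K p q f)"
    if pq: "p \<in> lobj Q" "q \<in> lobj Q" "f \<in> arr Q p q" for p q f
  proof (rule is_linearI)
    interpret G: left_module A "fobj G p" by (rule objD(1)[OF G pq(1)])
    note g = is_linearD[OF objD(2)[OF G pq]]
    fix x assume "x \<in> carrier (fobj ?K p)"
    then obtain x' where x: "x' \<in> carrier (fobj G p)" "x = ?r p x'" using el by blast
    show "farr ?K p q f x \<in> carrier (fobj ?K q)" using x farr pq g rcl by simp
    { fix y assume "y \<in> carrier (fobj ?K p)"
      then obtain y' where y: "y' \<in> carrier (fobj G p)" "y = ?r p y'" using el by blast
      show "farr ?K p q f (x \<oplus>\<^bsub>fobj ?K p\<^esub> y) = farr ?K p q f x \<oplus>\<^bsub>fobj ?K q\<^esub> farr ?K p q f y"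
        using x y farr pq g by (simp flip: add) }
    { fix a assume "a \<in> carrier A"
      then show "farr ?K p q f (a \<odot>\<^bsub>fobj ?K p\<^esub> x) = a \<odot>\<^bsub>fobj ?K q\<^esub> farr ?K p q f x"
        using x farr pq g G.smult_closed by (simp flip: smult) }
  qed
  show K: "?K \<in> lobj C"
  proof (rule objI[OF m l])
    fix p q f assume pq: "p \<in> lobj Q" "q \<in> lobj Q" "f \<in> arr Q p q"
    show "farr ?K p q f \<in> extensional (carrier (fobj ?K p))" by (simp add: coker_functor_def)
    fix x assume "x \<in> carrier (fobj ?K p)"
    then obtain x' where x: "x' \<in> carrier (fobj G p)" "x = ?r p x'" using el by blast
    { fix g assume "g \<in> arr Q p q" "f \<oplus>\<^bsub>lhom Q p q\<^esub> g \<in> arr Q p q"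
      then show "farr ?K p q (f \<oplus>\<^bsub>lhom Q p q\<^esub> g) x =
          farr ?K p q f x \<oplus>\<^bsub>fobj ?K q\<^esub> farr ?K p q g x"
        using x pq objD_closed[OF G] by (simp add: farr objD[OF G] flip: add) }
    { fix c assume "c \<in> carrier k" "c \<odot>\<^bsub>lhom Q p q\<^esub> f \<in> arr Q p q"
      then show "farr ?K p q (c \<odot>\<^bsub>lhom Q p q\<^esub> f) x = base_smult A (fobj ?K q) c (farr ?K p q f x)"
        using x pq objD_closed[OF G] base_scalar
        by (simp add: farr objD[OF G] base_smult_def flip: smult) }
    { fix r g assume "r \<in> lobj Q" "g \<in> arr Q q r" "lcomp Q p q r g f \<in> arr Q p r"
      then show "farr ?K p r (lcomp Q p q r g f) x = farr ?K q r g (farr ?K p q f x)"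
        using x pq objD_closed[OF G] by (simp add: farr objD[OF G]) }
  next
    fix q x assume q: "q \<in> lobj Q" and "x \<in> carrier (fobj ?K q)"
    then obtain x' where x: "x' \<in> carrier (fobj G q)" "x = ?r q x'" using el by blast
    then show "farr ?K q q (lid Q q) x = x" using q by (simp add: farr objD[OF G] Q.id_arr)
  qed
  show "(\<lambda>q\<in>lobj Q. \<lambda>x\<in>carrier (fobj G q). ?r q x) \<in> arr C G ?K"
    by (rule arrI) (simp_all add: r farr G objD(1)[OF G])
qed

text \<open>Exports of the construction just the pointwise description, in the form that
  \<open>is_kernelI\<close> expects; \<open>ex_cokernel\<close> does the same for
  \<open>is_cokernelI\<close>.\<close>

lemma ex_kernel:
  assumes "F \<in> lobj C" "G \<in> lobj C" "\<eta> \<in> arr C F G"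
  obtains K \<iota> where "K \<in> lobj C" "\<iota> \<in> arr C K F"
    "\<And>q. q \<in> lobj Q \<Longrightarrow> inj_on (\<iota> q) (carrier (fobj K q))"
    "\<And>q. q \<in> lobj Q \<Longrightarrow>
      \<iota> q ` carrier (fobj K q) = {x \<in> carrier (fobj F q). \<eta> q x = \<zero>\<^bsub>fobj G q\<^esub>}"
proof
  let ?\<iota> = "\<lambda>q\<in>lobj Q. \<lambda>x\<in>carrier (fobj (ker_functor F G \<eta>) q). x"
  show "ker_functor F G \<eta> \<in> lobj C" "?\<iota> \<in> arr C (ker_functor F G \<eta>) F"
    by (rule ker_functor[OF assms])+
  fix q assume q: "q \<in> lobj Q"
  then show "inj_on (?\<iota> q) (carrier (fobj (ker_functor F G \<eta>) q))" by (simp add: inj_on_def)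
  show "?\<iota> q ` carrier (fobj (ker_functor F G \<eta>) q) =
      {x \<in> carrier (fobj F q). \<eta> q x = \<zero>\<^bsub>fobj G q\<^esub>}"
    using q by (simp add: ker_functor_def)
qed

lemma ex_cokernel:
  assumes "F \<in> lobj C" "G \<in> lobj C" "\<eta> \<in> arr C F G"
  obtains K \<pi> where "K \<in> lobj C" "\<pi> \<in> arr C G K"
    "\<And>q. q \<in> lobj Q \<Longrightarrow> \<pi> q ` carrier (fobj G q) = carrier (fobj K q)"
    "\<And>q. q \<in> lobj Q \<Longrightarrow>
      {x \<in> carrier (fobj G q). \<pi> q x = \<zero>\<^bsub>fobj K q\<^esub>} = \<eta> q ` carrier (fobj F q)"
proof
  let ?\<pi> = "\<lambda>q\<in>lobj Q. \<lambda>x\<in>carrier (fobj G q). coset_rep (fobj F q) (fobj G q) (\<eta> q) x"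
  show "coker_functor F G \<eta> \<in> lobj C" "?\<pi> \<in> arr C G (coker_functor F G \<eta>)"
    by (rule coker_functor[OF assms])+
  fix q assume q: "q \<in> lobj Q"
  note lm = objD(1)[OF assms(1) q] objD(1)[OF assms(2) q] arrD(1)[OF assms(3) q]
  show "?\<pi> q ` carrier (fobj G q) = carrier (fobj (coker_functor F G \<eta>) q)"
    using q by (simp add: coker_functor_def)
  have "{x \<in> carrier (fobj G q). ?\<pi> q x = \<zero>\<^bsub>fobj (coker_functor F G \<eta>) q\<^esub>} =
      {x \<in> carrier (fobj G q). x \<in> \<eta> q ` carrier (fobj F q)}"
    using q by (intro Collect_cong) (auto simp: coker_functor_def coset_rep_zero_iff[OF lm])
  then show "{x \<in> carrier (fobj G q). ?\<pi> q x = \<zero>\<^bsub>fobj (coker_functor F G \<eta>) q\<^esub>} =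
      \<eta> q ` carrier (fobj F q)"
    using arrD(3)[OF assms(3) q] by auto
qed

text \<open>The arrow \<open>\<iota>\<close> is arbitrary, and not the inclusion of
  \<open>ker_functor\<close>, because the criterion must apply to a given monic, seen as a kernel of
  its cokernel. The factorization takes preimages under \<open>\<iota>\<close>; its linearity and
  naturality are checked after applying the injective \<open>\<iota>\<close>.\<close>

lemma is_kernelI:
  assumes obj: "K \<in> lobj C" "F \<in> lobj C" "G \<in> lobj C" and \<iota>: "\<iota> \<in> arr C K F" and \<eta>: "\<eta> \<in> arr C F G"
    and inj: "\<And>q. q \<in> lobj Q \<Longrightarrow> inj_on (\<iota> q) (carrier (fobj K q))"
    and im: "\<And>q. q \<in> lobj Q \<Longrightarrow>
      \<iota> q ` carrier (fobj K q) = {x \<in> carrier (fobj F q). \<eta> q x = \<zero>\<^bsub>fobj G q\<^esub>}"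
  shows "is_kernel C F G \<eta> K \<iota>"
  unfolding is_kernel_def
proof (intro conjI ballI impI obj \<iota> \<eta>)
  show "lcomp C K F G \<eta> \<iota> = zero_arr C K G"
    unfolding comp_zero_iff[OF obj(1,3) \<iota> \<eta>] using im by blast
  fix W g assume W: "W \<in> lobj C" and g: "g \<in> arr C W F" and z: "lcomp C W F G \<eta> g = zero_arr C W G"
  define h where "h = (\<lambda>q x. inv_into (carrier (fobj K q)) (\<iota> q) (g q x))"
  have gi: "g q x \<in> \<iota> q ` carrier (fobj K q)" if "q \<in> lobj Q" "x \<in> carrier (fobj W q)" for q x
    using z im that arrD(3)[OF g] unfolding comp_zero_iff[OF W obj(3) g \<eta>] by simp
  have h: "h q x \<in> carrier (fobj K q)" "\<iota> q (h q x) = g q x"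
    if "q \<in> lobj Q" "x \<in> carrier (fobj W q)" for q x
    using gi[OF that] unfolding h_def by (simp_all add: inv_into_into f_inv_into_f)
  have eqI: "a = b" if "q \<in> lobj Q" "\<iota> q a = \<iota> q b" "a \<in> carrier (fobj K q)" "b \<in> carrier (fobj K q)"
    for q a b
    using inj that by (meson inj_onD)
  let ?h = "\<lambda>q\<in>lobj Q. \<lambda>x\<in>carrier (fobj W q). h q x"
  have ha: "?h \<in> arr C W K"
  proof (rule arrI[OF _ _ W])
    fix q assume q: "q \<in> lobj Q"
    interpret W: left_module A "fobj W q" by (rule objD(1)[OF W q])
    interpret K: left_module A "fobj K q" by (rule objD(1)[OF obj(1) q])
    note l = is_linearD[OF arrD(1)[OF g q]] is_linearD[OF arrD(1)[OF \<iota> q]]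
    show "is_linear A (fobj W q) (fobj K q) (h q)"
    proof (rule is_linearI)
      fix x assume x: "x \<in> carrier (fobj W q)"
      then show "h q x \<in> carrier (fobj K q)" using h q by simp
      { fix y assume "y \<in> carrier (fobj W q)"
        then show "h q (x \<oplus>\<^bsub>fobj W q\<^esub> y) = h q x \<oplus>\<^bsub>fobj K q\<^esub> h q y"
          using x by (rule_tac eqI[OF q]) (simp_all add: h q l) }
      { fix a assume "a \<in> carrier A"
        then show "h q (a \<odot>\<^bsub>fobj W q\<^esub> x) = a \<odot>\<^bsub>fobj K q\<^esub> h q x"
          using x by (rule_tac eqI[OF q]) (simp_all add: h q l W.smult_closed K.smult_closed) }
    qed
  next
    fix p q f x assume "p \<in> lobj Q" "q \<in> lobj Q" "f \<in> arr Q p q" "x \<in> carrier (fobj W p)"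
      "farr W p q f x \<in> carrier (fobj W q)"
    then show "h q (farr W p q f x) = farr K p q f (h p x)"
      by (rule_tac eqI[of q]) (simp_all add: h objD_closed[OF obj(1)] arrD(2)[OF g] arrD(2)[OF \<iota>])
  qed
  show "\<exists>!h. h \<in> arr C W K \<and> lcomp C W K F \<iota> h = g"
  proof (rule ex1I[of _ ?h])
    show "?h \<in> arr C W K \<and> lcomp C W K F \<iota> ?h = g"
      by (intro conjI ha arr_eqI[OF comp_in_arr[OF W ha \<iota>] g]) (simp add: comp_apply h)
    fix h' assume h': "h' \<in> arr C W K \<and> lcomp C W K F \<iota> h' = g"
    show "h' = ?h"
    proof (rule arr_eqI[OF _ ha])
      fix q x assume qx: "q \<in> lobj Q" "x \<in> carrier (fobj W q)"
      have "\<iota> q (h' q x) = g q x" using h' comp_apply[OF qx] by metis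
      then show "h' q x = ?h q x"
        using h[OF qx] qx arrD(3) h' by (rule_tac eqI[OF qx(1)]) auto
    qed (use h' in blast)
  qed
qed

text \<open>The factorization evaluates \<open>g\<close> at some preimage under
  \<open>\<pi>\<close>. Two preimages differ by an element of the kernel of \<open>\<pi>\<close>,
  which is the image of \<open>\<eta>\<close>, and there \<open>g\<close> vanishes. Hence any
  preimage may be used to check linearity and naturality.\<close>

lemma is_cokernelI:
  assumes obj: "F \<in> lobj C" "G \<in> lobj C" "K \<in> lobj C" and \<eta>: "\<eta> \<in> arr C F G" and \<pi>: "\<pi> \<in> arr C G K"
    and surj: "\<And>q. q \<in> lobj Q \<Longrightarrow> \<pi> q ` carrier (fobj G q) = carrier (fobj K q)"
    and ker: "\<And>q. q \<in> lobj Q \<Longrightarrow>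
      {x \<in> carrier (fobj G q). \<pi> q x = \<zero>\<^bsub>fobj K q\<^esub>} = \<eta> q ` carrier (fobj F q)"
  shows "is_cokernel C F G \<eta> K \<pi>"
  unfolding is_cokernel_def
proof (intro conjI ballI impI obj \<eta> \<pi>)
  show "lcomp C F G K \<pi> \<eta> = zero_arr C F K"
    unfolding comp_zero_iff[OF obj(1,3) \<eta> \<pi>] using ker by blast
  fix W g assume W: "W \<in> lobj C" and g: "g \<in> arr C G W" and z: "lcomp C F G W g \<eta> = zero_arr C F W"
  define h where "h = (\<lambda>q z. g q (inv_into (carrier (fobj G q)) (\<pi> q) z))"
  have eq: "g q x = g q y"
    if q: "q \<in> lobj Q" and xy: "x \<in> carrier (fobj G q)" "y \<in> carrier (fobj G q)" "\<pi> q x = \<pi> q y" for q x y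
  proof -
    interpret G: left_module A "fobj G q" by (rule objD(1)[OF obj(2) q])
    have "x \<oplus>\<^bsub>fobj G q\<^esub> \<ominus>\<^bsub>fobj G q\<^esub> y \<in> \<eta> q ` carrier (fobj F q)"
      using ker[OF q] xy
        linear_eq_iff[OF objD(1)[OF obj(2) q] objD(1)[OF obj(3) q] arrD(1)[OF \<pi> q] xy(1,2)] by auto
    then have "g q (x \<oplus>\<^bsub>fobj G q\<^esub> \<ominus>\<^bsub>fobj G q\<^esub> y) = \<zero>\<^bsub>fobj W q\<^esub>"
      using z q unfolding comp_zero_iff[OF obj(1) W \<eta> g] by auto
    then show ?thesis
      using linear_eq_iff[OF objD(1)[OF obj(2) q] objD(1)[OF W q] arrD(1)[OF g q] xy(1,2)] by simp
  qed
  have h: "h q (\<pi> q x) = g q x" if qx: "q \<in> lobj Q" "x \<in> carrier (fobj G q)" for q x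
    unfolding h_def
    by (rule eq[OF qx(1)]) (use qx in \<open>auto intro: inv_into_into f_inv_into_f\<close>)
  have el: "\<exists>y\<in>carrier (fobj G q). x = \<pi> q y" if "q \<in> lobj Q" "x \<in> carrier (fobj K q)" for q x
    using surj that by blast
  let ?h = "\<lambda>q\<in>lobj Q. \<lambda>x\<in>carrier (fobj K q). h q x"
  have ha: "?h \<in> arr C K W"
  proof (rule arrI[OF _ _ obj(3)])
    fix q assume q: "q \<in> lobj Q"
    interpret G: left_module A "fobj G q" by (rule objD(1)[OF obj(2) q])
    note l = is_linearD[OF arrD(1)[OF g q]]
    note p = is_linearD[OF arrD(1)[OF \<pi> q]]
    show "is_linear A (fobj K q) (fobj W q) (h q)"
    proof (rule is_linearI)
      fix x assume "x \<in> carrier (fobj K q)"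
      then obtain x' where x: "x' \<in> carrier (fobj G q)" "x = \<pi> q x'" using el q by blast
      show "h q x \<in> carrier (fobj W q)" using x h q l by simp
      { fix y assume "y \<in> carrier (fobj K q)"
        then obtain y' where y: "y' \<in> carrier (fobj G q)" "y = \<pi> q y'" using el q by blast
        show "h q (x \<oplus>\<^bsub>fobj K q\<^esub> y) = h q x \<oplus>\<^bsub>fobj W q\<^esub> h q y"
          using x y q by (simp add: h l p(2)[symmetric]) }
      { fix a assume "a \<in> carrier A"
        then show "h q (a \<odot>\<^bsub>fobj K q\<^esub> x) = a \<odot>\<^bsub>fobj W q\<^esub> h q x"
          using x q G.smult_closed by (simp add: h l p(3)[symmetric]) }
    qed
  next
    fix p q f x assume pq: "p \<in> lobj Q" "q \<in> lobj Q" "f \<in> arr Q p q" and "x \<in> carrier (fobj K p)"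
    then obtain x' where x: "x' \<in> carrier (fobj G p)" "x = \<pi> p x'" using el by blast
    show "h q (farr K p q f x) = farr W p q f (h p x)"
      using x pq objD_closed[OF obj(2)]
      by (simp add: h arrD(2)[OF g] arrD(2)[OF \<pi>, symmetric])
  qed
  show "\<exists>!h. h \<in> arr C K W \<and> lcomp C G K W h \<pi> = g"
  proof (rule ex1I[of _ ?h])
    show "?h \<in> arr C K W \<and> lcomp C G K W ?h \<pi> = g"
      by (intro conjI ha arr_eqI[OF comp_in_arr[OF obj(2) \<pi> ha] g])
        (simp add: comp_apply h arrD(3)[OF \<pi>])
    fix h' assume h': "h' \<in> arr C K W \<and> lcomp C G K W h' \<pi> = g"
    show "h' = ?h"
    proof (rule arr_eqI[OF _ ha])
      fix q x assume qx: "q \<in> lobj Q" "x \<in> carrier (fobj K q)"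
      then obtain x' where x: "x' \<in> carrier (fobj G q)" "x = \<pi> q x'" using el by blast
      have "h' q x = g q x'" using h' comp_apply[OF qx(1) x(1)] x(2) by metis
      then show "h' q x = ?h q x" using qx x h by simp
    qed (use h' in blast)
  qed
qed

text \<open>Tested on the pointwise kernel, the condition forces its inclusion to vanish.
  Cancellation against zero is the form that \<open>monicI\<close> supplies and that every monic
  satisfies, so the lemma serves in both places.\<close>

lemma inj_if_trivial_kernel:
  assumes obj: "F \<in> lobj C" "G \<in> lobj C" and \<eta>: "\<eta> \<in> arr C F G"
    and triv: "\<And>W g. \<lbrakk>W \<in> lobj C; g \<in> arr C W F; lcomp C W F G \<eta> g = zero_arr C W G\<rbrakk> \<Longrightarrow>
      g = zero_arr C W F"
    and q: "q \<in> lobj Q"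
  shows "inj_on (\<eta> q) (carrier (fobj F q))"
proof -
  obtain K \<iota> where K: "K \<in> lobj C" "\<iota> \<in> arr C K F"
    and im: "\<And>q. q \<in> lobj Q \<Longrightarrow>
      \<iota> q ` carrier (fobj K q) = {x \<in> carrier (fobj F q). \<eta> q x = \<zero>\<^bsub>fobj G q\<^esub>}"
    by (rule ex_kernel[OF obj \<eta>]) (rule that)
  have "lcomp C K F G \<eta> \<iota> = zero_arr C K G"
    unfolding comp_zero_iff[OF K(1) obj(2) K(2) \<eta>] using im by blast
  then have "\<iota> = zero_arr C K F" using triv K by blast
  then have "x = \<zero>\<^bsub>fobj F q\<^esub>" if "x \<in> carrier (fobj F q)" "\<eta> q x = \<zero>\<^bsub>fobj G q\<^esub>" for x
    using im[OF q] that zero_apply[OF q] by force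
  then show ?thesis
    using inj_on_if_trivial_kernel[OF objD(1)[OF obj(1) q] objD(1)[OF obj(2) q] arrD(1)[OF \<eta> q]] by blast
qed

text \<open>Tested on the pointwise cokernel, the condition forces the projection to vanish, so its
  kernel, the image of \<open>\<eta> q\<close>, is everything.\<close>

lemma surj_if_trivial_cokernel:
  assumes obj: "F \<in> lobj C" "G \<in> lobj C" and \<eta>: "\<eta> \<in> arr C F G"
    and triv: "\<And>W g. \<lbrakk>W \<in> lobj C; g \<in> arr C G W; lcomp C F G W g \<eta> = zero_arr C F W\<rbrakk> \<Longrightarrow>
      g = zero_arr C G W"
    and q: "q \<in> lobj Q"
  shows "\<eta> q ` carrier (fobj F q) = carrier (fobj G q)"
proof -
  obtain K \<pi> where K: "K \<in> lobj C" "\<pi> \<in> arr C G K"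
    and ker: "\<And>q. q \<in> lobj Q \<Longrightarrow>
      {x \<in> carrier (fobj G q). \<pi> q x = \<zero>\<^bsub>fobj K q\<^esub>} = \<eta> q ` carrier (fobj F q)"
    by (rule ex_cokernel[OF obj \<eta>]) (rule that)
  have "lcomp C F G K \<pi> \<eta> = zero_arr C F K"
    unfolding comp_zero_iff[OF obj(1) K(1) \<eta> K(2)] using ker by blast
  then have "\<pi> = zero_arr C G K" using triv K by blast
  then show ?thesis using ker[OF q] zero_apply[OF q, of _ G K] by auto
qed

lemma monic_if_inj:
  assumes obj: "F \<in> lobj C" and \<eta>: "\<eta> \<in> arr C F G"
    and inj: "\<And>q. q \<in> lobj Q \<Longrightarrow> inj_on (\<eta> q) (carrier (fobj F q))"
  shows "monic C F G \<eta>"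
  unfolding monic_def
proof (intro conjI ballI impI \<eta>)
  fix W g h assume W: "W \<in> lobj C" and g: "g \<in> arr C W F" and h: "h \<in> arr C W F"
    and eq: "lcomp C W F G \<eta> g = lcomp C W F G \<eta> h"
  show "g = h"
  proof (rule arr_eqI[OF g h])
    fix q x assume qx: "q \<in> lobj Q" "x \<in> carrier (fobj W q)"
    have "\<eta> q (g q x) = \<eta> q (h q x)" using eq comp_apply[OF qx] by metis
    then show "g q x = h q x"
      using inj[OF qx(1)] arrD(3)[OF g qx] arrD(3)[OF h qx] by (meson inj_onD)
  qed
qed

lemma epic_if_surj:
  assumes \<eta>: "\<eta> \<in> arr C F G"
    and surj: "\<And>q. q \<in> lobj Q \<Longrightarrow> \<eta> q ` carrier (fobj F q) = carrier (fobj G q)"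
  shows "epic C F G \<eta>"
  unfolding epic_def
proof (intro conjI ballI impI \<eta>)
  fix W g h assume W: "W \<in> lobj C" and g: "g \<in> arr C G W" and h: "h \<in> arr C G W"
    and eq: "lcomp C F G W g \<eta> = lcomp C F G W h \<eta>"
  show "g = h"
  proof (rule arr_eqI[OF g h])
    fix q x assume qx: "q \<in> lobj Q" "x \<in> carrier (fobj G q)"
    then obtain y where y: "y \<in> carrier (fobj F q)" "x = \<eta> q y" using surj by blast
    show "g q x = h q x" unfolding y(2) using eq comp_apply[OF qx(1) y(1)] by metis
  qed
qed

text \<open>Normality comes down to elements: a monic is injective in each component, so it is a
  kernel of the projection onto the quotient by its image; an epic is surjective in each component,
  so it is a cokernel of the inclusion of its kernel.\<close>

theorem normal_category: "normal_category C"
proof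
  fix F G :: "('q, 'h, ('a, 'm) module, 'm \<Rightarrow> 'm) linfun" and \<eta>
  assume FG: "F \<in> lobj C" "G \<in> lobj C"
  show "lid C F \<in> arr C F F" "zero_arr C F G \<in> arr C F G" using id_in_arr zero_in_arr FG by blast+
  { fix H \<theta> assume "H \<in> lobj C" "\<eta> \<in> arr C F G" "\<theta> \<in> arr C G H"
    then show "lcomp C F G H \<theta> \<eta> \<in> arr C F H" using comp_in_arr FG by blast }
  { assume \<eta>: "\<eta> \<in> arr C F G"
    show "lcomp C F G G (lid C G) \<eta> = \<eta>"
      by (rule arr_eqI[OF comp_in_arr[OF FG(1) \<eta> id_in_arr[OF FG(2)]] \<eta>])
        (simp add: comp_apply id_apply arrD(3)[OF \<eta>])
    show "lcomp C F F G \<eta> (lid C F) = \<eta>"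
      by (rule arr_eqI[OF comp_in_arr[OF FG(1) id_in_arr[OF FG(1)] \<eta>] \<eta>])
        (simp add: comp_apply id_apply) }
  { fix W X f g assume W: "W \<in> lobj C" "X \<in> lobj C"
      and f: "f \<in> arr C W X" and g: "g \<in> arr C X F" and \<eta>: "\<eta> \<in> arr C F G"
    show "lcomp C W F G \<eta> (lcomp C W X F g f) = lcomp C W X G (lcomp C X F G \<eta> g) f"
      by (rule arr_eqI[OF comp_in_arr[OF W(1) comp_in_arr[OF W(1) f g] \<eta>]
            comp_in_arr[OF W(1) f comp_in_arr[OF W(2) g \<eta>]]])
        (simp add: comp_apply arrD(3)[OF f]) }
  { fix H assume H: "H \<in> lobj C" and \<eta>: "\<eta> \<in> arr C G H"
    show "lcomp C F G H \<eta> (zero_arr C F G) = zero_arr C F H"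
      unfolding comp_zero_iff[OF FG(1) H zero_in_arr[OF FG] \<eta>]
      by (simp add: zero_apply arr_zero[OF FG(2) H \<eta>]) }
  { fix H :: "('q, 'h, ('a, 'm) module, 'm \<Rightarrow> 'm) linfun"
    assume H: "H \<in> lobj C" and \<eta>: "\<eta> \<in> arr C F G"
    show "lcomp C F G H (zero_arr C G H) \<eta> = zero_arr C F H"
      unfolding comp_zero_iff[OF FG(1) H \<eta> zero_in_arr[OF FG(2) H]]
      by (simp add: zero_apply arrD(3)[OF \<eta>]) }
  { assume \<eta>: "\<eta> \<in> arr C F G"
      and triv: "\<And>W g. \<lbrakk>W \<in> lobj C; g \<in> arr C W F; lcomp C W F G \<eta> g = zero_arr C W G\<rbrakk> \<Longrightarrow>
        g = zero_arr C W F"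
    show "monic C F G \<eta>"
      using monic_if_inj[OF FG(1) \<eta>] inj_if_trivial_kernel[OF FG \<eta> triv] by blast }
  { assume \<eta>: "\<eta> \<in> arr C F G"
      and triv: "\<And>W g. \<lbrakk>W \<in> lobj C; g \<in> arr C G W; lcomp C F G W g \<eta> = zero_arr C F W\<rbrakk> \<Longrightarrow>
        g = zero_arr C G W"
    show "epic C F G \<eta>"
      using epic_if_surj[OF \<eta>] surj_if_trivial_cokernel[OF FG \<eta> triv] by blast }
  { assume m: "monic C F G \<eta>"
    then have \<eta>: "\<eta> \<in> arr C F G" unfolding monic_def by blast
    have inj: "inj_on (\<eta> q) (carrier (fobj F q))" if "q \<in> lobj Q" for q
    proof (rule inj_if_trivial_kernel[OF FG \<eta> _ that])
      fix W g assume W: "W \<in> lobj C" "g \<in> arr C W F" "lcomp C W F G \<eta> g = zero_arr C W G"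
      moreover have "lcomp C W F G \<eta> (zero_arr C W F) = zero_arr C W G"
        using comp_zero_iff[OF W(1) FG(2) zero_in_arr[OF W(1) FG(1)] \<eta>] arr_zero[OF FG \<eta>]
        by (simp add: zero_apply)
      ultimately show "g = zero_arr C W F"
        using m zero_in_arr[OF W(1) FG(1)] unfolding monic_def by metis
    qed
    obtain K \<pi> where K: "K \<in> lobj C" "\<pi> \<in> arr C G K"
      "\<And>q. q \<in> lobj Q \<Longrightarrow> \<pi> q ` carrier (fobj G q) = carrier (fobj K q)"
      "\<And>q. q \<in> lobj Q \<Longrightarrow>
        {x \<in> carrier (fobj G q). \<pi> q x = \<zero>\<^bsub>fobj K q\<^esub>} = \<eta> q ` carrier (fobj F q)"
      by (rule ex_cokernel[OF FG \<eta>]) (rule that)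
    \<comment> \<open>The equation between the kernel of \<open>\<pi>\<close> and the image of
      \<open>\<eta>\<close> serves twice: as it stands for the cokernel, and read backwards for the
      kernel.\<close>
    have "is_cokernel C F G \<eta> K \<pi>" by (rule is_cokernelI[OF FG K(1) \<eta> K(2-4)])
    moreover have "is_kernel C G K \<pi> F \<eta>" by (rule is_kernelI[OF FG K(1) \<eta> K(2) inj K(4)[symmetric]])
    ultimately show "\<exists>Z c. is_cokernel C F G \<eta> Z c \<and> is_kernel C G Z c F \<eta>" by blast }
  { assume e: "epic C F G \<eta>"
    then have \<eta>: "\<eta> \<in> arr C F G" unfolding epic_def by blast
    have surj: "\<eta> q ` carrier (fobj F q) = carrier (fobj G q)" if "q \<in> lobj Q" for q
    proof (rule surj_if_trivial_cokernel[OF FG \<eta> _ that])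
      fix W g assume W: "W \<in> lobj C" "g \<in> arr C G W" "lcomp C F G W g \<eta> = zero_arr C F W"
      moreover have "lcomp C F G W (zero_arr C G W) \<eta> = zero_arr C F W"
        using comp_zero_iff[OF FG(1) W(1) \<eta> zero_in_arr[OF FG(2) W(1)]]
        by (simp add: zero_apply arrD(3)[OF \<eta>])
      ultimately show "g = zero_arr C G W"
        using e zero_in_arr[OF FG(2) W(1)] unfolding epic_def by metis
    qed
    obtain K \<iota> where K: "K \<in> lobj C" "\<iota> \<in> arr C K F"
      "\<And>q. q \<in> lobj Q \<Longrightarrow> inj_on (\<iota> q) (carrier (fobj K q))"
      "\<And>q. q \<in> lobj Q \<Longrightarrow>
        \<iota> q ` carrier (fobj K q) = {x \<in> carrier (fobj F q). \<eta> q x = \<zero>\<^bsub>fobj G q\<^esub>}"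
      by (rule ex_kernel[OF FG \<eta>]) (rule that)
    have "is_kernel C F G \<eta> K \<iota>" by (rule is_kernelI[OF K(1) FG K(2) \<eta> K(3,4)])
    moreover have "is_cokernel C K F \<iota> G \<eta>"
      by (rule is_cokernelI[OF K(1) FG K(2) \<eta> surj K(4)[symmetric]])
    ultimately show "\<exists>K j. is_kernel C F G \<eta> K j \<and> is_cokernel C K F j G \<eta>" by blast }
qed (use zero_functor_is_zero in blast)

end


section \<open>Comparison of the projective and the injective model structure\<close>

theorem proposition6p3:
  fixes k :: "'u ring"
    and Q :: "('q, 'u, 'u) lincat"
    and A :: "('u, 'u) module"
    and C :: "(('q, 'u, ('u, 'u) module, 'u \<Rightarrow> 'u) linfun, 'q \<Rightarrow> 'u \<Rightarrow> 'u, 'u) lincat"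
    and \<E> :: "('q, 'u, ('u, 'u) module, 'u \<Rightarrow> 'u) linfun set"
    and Mproj Minj :: "(('q, 'u, ('u, 'u) module, 'u \<Rightarrow> 'u) linfun, 'q \<Rightarrow> 'u \<Rightarrow> 'u) model_str"
  assumes "cring k" and "\<one>\<^bsub>k\<^esub> \<noteq> \<zero>\<^bsub>k\<^esub>"
    and "linear_category k Q"
    and "assoc_algebra k A"
    and "hom_finite k Q" and "locally_bounded Q"
    and "has_serre_functor k Q" and "retraction_property k Q"
    and "gorenstein k"
    and "finite_proj_dim (base_Mod k) A \<or> finite_inj_dim (base_Mod k) A"
    and "C = QA_Mod k Q A" and "\<E> = exact_objects k Q A"
    and "projective_model_structure C \<E> Mproj"
    and "injective_model_structure C \<E> Minj"
  shows "(\<forall>X\<in>lobj C. \<forall>Y\<in>lobj C. weq Mproj X Y = weq Minj X Y) \<and>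
    (\<forall>X\<in>lobj C. \<forall>Y\<in>lobj C. \<forall>\<phi>\<in>arr C X Y.
       (\<phi> \<in> weq Mproj X Y \<longleftrightarrow> factors_mono_epi C \<E> \<E> X Y \<phi>) \<and>
       (\<phi> \<in> weq Minj X Y \<longleftrightarrow> factors_mono_epi C \<E> \<E> X Y \<phi>) \<and>
       (factors_mono_epi C \<E> \<E> X Y \<phi> \<longleftrightarrow> factors_mono_epi C (projectives C) \<E> X Y \<phi>) \<and>
       (factors_mono_epi C \<E> \<E> X Y \<phi> \<longleftrightarrow> factors_mono_epi C \<E> (injectives C) X Y \<phi>))"
proof -
  interpret proj: all_fibrant_model C Mproj
  proof (intro all_fibrant_model.intro all_fibrant_model_axioms.intro)
    show "normal_category C" unfolding assms(11)
      by (rule module_functors.normal_category[OF module_functors.intro[OF assms(3,4)]])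
  qed (use assms(13) in \<open>simp_all add: projective_model_structure_def\<close>)
  \<comment> \<open>Reversing arrows exchanges cofibrant and fibrant objects, so every object is
    fibrant for the reversed injective structure.\<close>
  interpret inj: all_fibrant_model "op_cat C" "op_model Minj"
  proof (intro all_fibrant_model.intro all_fibrant_model_axioms.intro)
    show "normal_category (op_cat C)" by (rule proj.op_normal_category)
  qed (use assms(14) in
      \<open>simp_all add: injective_model_structure_def op_abelian_model_structure\<close>)
  have E: "trivial_objects C Mproj = \<E>" "trivial_objects C Minj = \<E>"
    using assms(13,14)
    by (simp_all add: projective_model_structure_def injective_model_structure_def)
  show ?thesis
  proof (intro conjI ballI)
    fix X Y assume XY: "X \<in> lobj C" "Y \<in> lobj C"
    note P = proj.weq_iff_factors[OF XY, unfolded E]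
    \<comment> \<open>The instance is taken at \<open>Y\<close>, \<open>X\<close>, since an arrow
      from \<open>X\<close> to \<open>Y\<close> runs from \<open>Y\<close> to \<open>X\<close> in
      the opposite category. Undoing the reversal turns projectives into injectives and moves them
      from the cokernel to the kernel of the factorization.\<close>
    have I: "\<phi> \<in> weq Minj X Y \<longleftrightarrow> factors_mono_epi C \<E> \<E> X Y \<phi>"
      "\<phi> \<in> weq Minj X Y \<longleftrightarrow> factors_mono_epi C \<E> (injectives C) X Y \<phi>" for \<phi>
      using inj.weq_iff_factors[of Y X \<phi>] XY by (simp_all add: E)
    show "weq Mproj X Y = weq Minj X Y" using P(1) I(1) by blast
    fix \<phi>
    show "\<phi> \<in> weq Mproj X Y \<longleftrightarrow> factors_mono_epi C \<E> \<E> X Y \<phi>" by (rule P(1))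
    show "\<phi> \<in> weq Minj X Y \<longleftrightarrow> factors_mono_epi C \<E> \<E> X Y \<phi>" by (rule I(1))
    show "factors_mono_epi C \<E> \<E> X Y \<phi> \<longleftrightarrow> factors_mono_epi C (projectives C) \<E> X Y \<phi>"
      using P by blast
    show "factors_mono_epi C \<E> \<E> X Y \<phi> \<longleftrightarrow> factors_mono_epi C \<E> (injectives C) X Y \<phi>"
      using I by blast
  qed
qed

end
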